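(* There exists a set of reals $X$ satisfying $\mathsf S_{fin}(\Omega,\Omega)$ but not $\mathsf U_{fin}(\mathcal O,\mathrm T)$.
   Context: "Set of reals" means a separable, zero-dimensional metrizable space (equivalently, up to homeomorphism, a zero-dimensional subspace of $\mathbb R$). For a set of reals $X$: $\mathcal O$ is the collection of all open covers of $X$. An open cover $\mathcal U$ of $X$ is an $\omega$-cover if $X\notin\mathcal U$ and for each finite $F\subseteq X$ there is $U\in\mathcal U$ with $F\subseteq U$; $\Omega$ is the collection of all countable open $\omega$-covers of $X$. An open cover $\mathcal U$ of $X$ is a $\tau$-cover if each member of $X$ is covered by infinitely many members of $\mathcal U$, and for all $x,y\in X$, at least one of the sets $\{U\in\mathcal U:x\in U,\ y\notin U\}$ and $\{U\in\mathcal U:y\in U,\ x\notin U\}$ is finite; $\mathrm T$ is the collection of all countable open $\tau$-covers of $X$. For collections $\mathscr A,\mathscr B$ of covers of $X$: $\mathsf S_{fin}(\mathscr A,\mathscr B)$: for each sequence $\{\mathcal U_n\}_{n\in\mathbb N}$ of members of $\mathscr A$, there exist finite (possibly empty) subsets $\mathcal F_n\subseteq\mathcal U_n$, $n\in\mathbb N$, such that $\bigcup_n\mathcal F_n\in\mathscr B$. $\mathsf U_{fin}(\mathscr A,\mathscr B)$: for each sequence $\{\mathcal U_n\}_{n\in\mathbb N}$ of members of $\mathscr A$ which do not contain a finite subcover, there exist finite subsets $\mathcal F_n\subseteq\mathcal U_n$, $n\in\mathbb N$, such that $\{\bigcup\mathcal F_n:n\in\mathbb N\}\in\mathscr B$.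 *)

theory Defs
  imports "HOL-Analysis.Analysis"
begin

definition zero_dimensional_space :: "'a topology \<Rightarrow> bool" where
  "zero_dimensional_space X \<longleftrightarrow>
     (\<forall>U x. openin X U \<and> x \<in> U \<longrightarrow>
        (\<exists>C. openin X C \<and> closedin X C \<and> x \<in> C \<and> C \<subseteq> U))"

definition set_of_reals :: "'a topology \<Rightarrow> bool" where
  "set_of_reals X \<longleftrightarrow>
     separable_space X \<and> zero_dimensional_space X \<and> metrizable_space X"

(* A cover is a set of subsets of the space, not an indexed family.  The whole space may be
   a member, and so may the empty set. *)
definition open_covers :: "'a topology \<Rightarrow> 'a set set set" where
  "open_covers X = {\<U>. (\<forall>U\<in>\<U>. openin X U) \<and> \<Union>\<U> = topspace X}"

definition omega_covers :: "'a topology \<Rightarrow> 'a set set set" where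
  "omega_covers X =
     {\<U> \<in> open_covers X. countable \<U> \<and> topspace X \<notin> \<U> \<and>
        (\<forall>F. finite F \<and> F \<subseteq> topspace X \<longrightarrow> (\<exists>U\<in>\<U>. F \<subseteq> U))}"

definition tau_covers :: "'a topology \<Rightarrow> 'a set set set" where
  "tau_covers X =
     {\<U> \<in> open_covers X. countable \<U> \<and>
        (\<forall>x\<in>topspace X. infinite {U \<in> \<U>. x \<in> U}) \<and>
        (\<forall>x\<in>topspace X. \<forall>y\<in>topspace X.
           finite {U \<in> \<U>. x \<in> U \<and> y \<notin> U} \<or> finite {U \<in> \<U>. y \<in> U \<and> x \<notin> U})}"

definition S_fin :: "'a set set set \<Rightarrow> 'a set set set \<Rightarrow> bool" where
  "S_fin \<A> \<B> \<longleftrightarrow>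
     (\<forall>\<U> :: nat \<Rightarrow> 'a set set. (\<forall>n. \<U> n \<in> \<A>) \<longrightarrow>
        (\<exists>\<F>. (\<forall>n. finite (\<F> n) \<and> \<F> n \<subseteq> \<U> n) \<and> (\<Union>n. \<F> n) \<in> \<B>))"

definition U_fin :: "'a topology \<Rightarrow> 'a set set set \<Rightarrow> 'a set set set \<Rightarrow> bool" where
  "U_fin X \<A> \<B> \<longleftrightarrow>
     (\<forall>\<U> :: nat \<Rightarrow> 'a set set.
        (\<forall>n. \<U> n \<in> \<A> \<and> \<not> (\<exists>\<V>. finite \<V> \<and> \<V> \<subseteq> \<U> n \<and> \<Union>\<V> = topspace X)) \<longrightarrow>
        (\<exists>\<F>. (\<forall>n. finite (\<F> n) \<and> \<F> n \<subseteq> \<U> n) \<and> range (\<lambda>n. \<Union>(\<F> n)) \<in> \<B>))"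

end

theory Submission
  imports Defs
begin

text \<open>
  Let \<open>D\<close> be a dominating family of least cardinality \<open>\<delta>\<close>, and call a family of sets of naturals
  finitely splitting if, for every \<open>f\<close>, some member contains infinitely many and misses infinitely
  many of the intervals \<open>[c, f c)\<close>.

  If some finitely splitting family \<open>Y\<close> has fewer than \<open>\<delta>\<close> members, the finite sets together with
  the members of \<open>Y\<close> and their complements form a witness: \<open>S\<^sub>f\<^sub>i\<^sub>n(\<Omega>, \<Omega>)\<close> holds for reasons of
  cardinality, and the covers \<open>{x. \<not> [n, m) \<subseteq> x}\<close>, \<open>m > n\<close>, defeat \<open>U\<^sub>f\<^sub>i\<^sub>n(O, T)\<close>.

  Otherwise \<open>\<delta>\<close> is regular. Indeed, if \<open>D\<close> is a union of fewer than \<open>\<delta>\<close> pieces \<open>E t\<close> of size less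
  than \<open>\<delta>\<close>, there is an unbounded family \<open>B\<close> of size less than \<open>\<delta>\<close>. Since nothing small splits
  finitely, every small family of sets is left unsplit by a single infinite set; applied to the sets
  \<open>{n. d n \<le> b n}\<close> with \<open>d \<in> E t\<close>, \<open>b \<in> B\<close>, this gives \<open>K t\<close> such that each \<open>d \<in> E t\<close> lies eventually
  below some \<open>b\<close> on \<open>K t\<close>. The functions \<open>b (next element of K t)\<close> then form a dominating family that
  is too small. When \<open>\<delta>\<close> is regular, a recursion along \<open>D\<close> produces disjoint pairs of sets containing
  infinitely many intervals \<open>[c, a c)\<close>, \<open>a \<in> D\<close>, and otherwise so sparse that finitely many of them
  late in the well-order simultaneously miss an interval \<open>[n, b n)\<close> for any given earlier \<open>b\<close>. The
  sparseness yields \<open>S\<^sub>f\<^sub>i\<^sub>n(\<Omega>, \<Omega>)\<close> by a closing-off argument.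
\<close>

unbundle cardinal_syntax

section \<open>Sets of naturals as reals\<close>

text \<open>Base 3 with only the digits 0 and 1: the tail after place m sums to at most half of
  (1/3)^m, so the first differing digit decides. This embeds the Cantor space of sets of naturals
  into the reals.\<close>

definition enc :: "nat set \<Rightarrow> real" where
  "enc x = (\<Sum>n. indicator x n * (1/3) ^ n)"

lemma enc_summable: "summable (\<lambda>n. indicator x n * (1/3) ^ n :: real)"
  by (rule summable_comparison_test'[OF summable_geometric[of "1/3 :: real"], of 0])
     (auto simp: indicator_def)

lemma enc_bounds: "0 \<le> enc x" "enc x \<le> 3/2"
proof -
  show "0 \<le> enc x"
    unfolding enc_def by (rule suminf_nonneg[OF enc_summable]) (auto simp: indicator_def)
  have "enc x \<le> (\<Sum>n. (1/3) ^ n)"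
    unfolding enc_def
    by (rule suminf_le[OF _ enc_summable summable_geometric]) (auto simp: indicator_def)
  also have "\<dots> = 3/2"
    by (subst suminf_geometric) auto
  finally show "enc x \<le> 3/2" .
qed

lemma enc_split:
  "enc x = (\<Sum>n<k. indicator x n * (1/3) ^ n) + (1/3) ^ k * enc {n. n + k \<in> x}"
proof -
  have "enc x = (\<Sum>n. indicator x (n + k) * (1/3) ^ (n + k)) + (\<Sum>n<k. indicator x n * (1/3) ^ n)"
    unfolding enc_def by (rule suminf_split_initial_segment[OF enc_summable])
  also have "(\<Sum>n. indicator x (n + k) * (1/3) ^ (n + k) :: real)
      = (\<Sum>n. (1/3) ^ k * (indicator {n. n + k \<in> x} n * (1/3) ^ n))"
    by (simp add: power_add indicator_def mult_ac)
  also have "\<dots> = (1/3) ^ k * enc {n. n + k \<in> x}"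
    unfolding enc_def by (rule suminf_mult[OF enc_summable])
  finally show ?thesis by simp
qed

lemma enc_close:
  assumes "x \<inter> {..<k} = y \<inter> {..<k}"
  shows "\<bar>enc x - enc y\<bar> \<le> 3/2 * (1/3) ^ k"
proof -
  have "(\<Sum>n<k. indicator x n * (1/3) ^ n) = (\<Sum>n<k. indicator y n * (1/3) ^ n :: real)"
    using assms by (intro sum.cong) (auto simp: indicator_def)
  then have "enc x - enc y = (1/3) ^ k * (enc {n. n + k \<in> x} - enc {n. n + k \<in> y})"
    by (simp add: enc_split[of x k] enc_split[of y k] algebra_simps)
  moreover have "\<bar>enc {n. n + k \<in> x} - enc {n. n + k \<in> y}\<bar> \<le> 3/2"
    using enc_bounds[of "{n. n + k \<in> x}"] enc_bounds[of "{n. n + k \<in> y}"] by linarith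
  ultimately show ?thesis
    by (simp add: abs_mult mult.commute mult_left_mono)
qed

text \<open>At the least place m of disagreement one code gains (1/3)^m, and all later digits
  together take back at most half of that.\<close>

lemma enc_far:
  assumes "x \<inter> {..<k} \<noteq> y \<inter> {..<k}"
  shows "(1/3) ^ k \<le> \<bar>enc x - enc y\<bar>"
proof -
  obtain m where m: "m < k" "(m \<in> x) \<noteq> (m \<in> y)" "\<And>i. i < m \<Longrightarrow> (i \<in> x) = (i \<in> y)"
  proof -
    define m where "m = (LEAST m. (m \<in> x) \<noteq> (m \<in> y))"
    from assms obtain j where j: "j < k" "(j \<in> x) \<noteq> (j \<in> y)" by auto
    have "(m \<in> x) \<noteq> (m \<in> y)"
      unfolding m_def using j(2) by (rule LeastI)
    moreover have "m \<le> j"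
      unfolding m_def using j(2) by (rule Least_le)
    then have "m < k" using j(1) by simp
    moreover have "(i \<in> x) = (i \<in> y)" if "i < m" for i
      using not_less_Least[OF that[unfolded m_def]] by simp
    ultimately show thesis using that by blast
  qed
  have half: "1/2 * (1/3) ^ m \<le> enc u - enc v"
    if "m \<in> u" "m \<notin> v" "\<And>i. i < m \<Longrightarrow> (i \<in> u) = (i \<in> v)" for u v
  proof -
    have "(\<Sum>n<m. indicator u n * (1/3) ^ n) = (\<Sum>n<m. indicator v n * (1/3) ^ n :: real)"
      using that(3) by (intro sum.cong) (auto simp: indicator_def)
    then have "enc u - enc v = (1/3) ^ m + (1/3) ^ Suc m * (enc {n. n + Suc m \<in> u} - enc {n. n + Suc m \<in> v})"
      using that(1,2) by (simp add: enc_split[of u "Suc m"] enc_split[of v "Suc m"] algebra_simps)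
    moreover have "(1/3) ^ Suc m * (enc {n. n + Suc m \<in> u} - enc {n. n + Suc m \<in> v}) \<ge> (1/3) ^ Suc m * (- (3/2))"
      using enc_bounds[of "{n. n + Suc m \<in> u}"] enc_bounds[of "{n. n + Suc m \<in> v}"]
      by (intro mult_left_mono) auto
    ultimately show ?thesis by simp
  qed
  have "(1/3::real) ^ k \<le> (1/3) ^ Suc m"
    using m(1) by (intro power_decreasing) auto
  moreover have "0 \<le> (1/3::real) ^ m" by simp
  ultimately have "(1/3::real) ^ k \<le> 1/2 * (1/3) ^ m"
    unfolding power_Suc by linarith
  also have "\<dots> \<le> \<bar>enc x - enc y\<bar>"
  proof (cases "m \<in> x")
    case True
    with half[of x y] m(2,3) have "1/2 * (1/3) ^ m \<le> enc x - enc y" by blast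
    then show ?thesis by linarith
  next
    case False
    with half[of y x] m(2,3) have "1/2 * (1/3) ^ m \<le> enc y - enc x" by blast
    then show ?thesis by linarith
  qed
  finally show ?thesis .
qed

lemma enc_inj: "enc x = enc y \<longleftrightarrow> x = y"
proof
  assume eq: "enc x = enc y"
  have "x \<inter> {..<k} = y \<inter> {..<k}" for k
  proof (rule ccontr)
    assume "x \<inter> {..<k} \<noteq> y \<inter> {..<k}"
    then have "(1/3 :: real) ^ k \<le> 0" using enc_far[of x k y] eq by simp
    moreover have "(0 :: real) < (1/3) ^ k" by simp
    ultimately show False by linarith
  qed
  then have "(n \<in> x) = (n \<in> y)" for n
    by (metis Int_iff lessI lessThan_iff)
  then show "x = y" by blast
qed simp

text \<open>By \<open>enc_close\<close> and \<open>enc_far\<close>, nearness of codes is agreement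
  on an initial segment. Openness arguments below go through this description instead of the
  metric.\<close>

lemma openin_enc_image:
  "openin (top_of_set (enc ` S)) U \<longleftrightarrow>
     U \<subseteq> enc ` S \<and> (\<forall>x\<in>S. enc x \<in> U \<longrightarrow> (\<exists>k. \<forall>y\<in>S. y \<inter> {..<k} = x \<inter> {..<k} \<longrightarrow> enc y \<in> U))"
  (is "?L \<longleftrightarrow> ?R")
proof
  assume ?L
  then have U: "U \<subseteq> enc ` S" and e: "\<And>u. u \<in> U \<Longrightarrow> \<exists>e>0. \<forall>v\<in>enc ` S. dist v u < e \<longrightarrow> v \<in> U"
    by (auto simp: openin_euclidean_subtopology_iff)
  have "\<exists>k. \<forall>y\<in>S. y \<inter> {..<k} = x \<inter> {..<k} \<longrightarrow> enc y \<in> U" if x: "x \<in> S" "enc x \<in> U" for x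
  proof -
    obtain e where "e > 0" and eU: "\<And>y. y \<in> S \<Longrightarrow> dist (enc y) (enc x) < e \<Longrightarrow> enc y \<in> U"
      using e[OF x(2)] by auto
    obtain k where k: "(1/3) ^ k < e / (3/2)"
      using real_arch_pow_inv[of "e / (3/2)" "1/3"] \<open>e > 0\<close> by auto
    have "enc y \<in> U" if "y \<in> S" "y \<inter> {..<k} = x \<inter> {..<k}" for y
    proof (rule eU[OF that(1)])
      show "dist (enc y) (enc x) < e"
      proof -
        have "3/2 * (1/3) ^ k < e" using k by simp
        then show ?thesis
          unfolding dist_real_def using enc_close[OF that(2)] by linarith
      qed
    qed
    then show ?thesis by blast
  qed
  with U show ?R by blast
next
  assume R: ?R
  have ball: "\<exists>e>0. \<forall>v\<in>enc ` S. dist v u < e \<longrightarrow> v \<in> U" if "u \<in> U" for u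
  proof -
    obtain x where x: "x \<in> S" "u = enc x" using R \<open>u \<in> U\<close> by blast
    have "enc x \<in> U" using x(2) \<open>u \<in> U\<close> by simp
    with R x(1) obtain k where k: "\<And>y. y \<in> S \<Longrightarrow> y \<inter> {..<k} = x \<inter> {..<k} \<Longrightarrow> enc y \<in> U"
      by metis
    have "enc y \<in> U" if "y \<in> S" "dist (enc y) u < (1/3) ^ k" for y
    proof (rule k[OF that(1)], rule ccontr)
      assume "y \<inter> {..<k} \<noteq> x \<inter> {..<k}"
      from enc_far[OF this] that(2) show False by (simp add: dist_real_def x(2))
    qed
    then show ?thesis
      by (intro exI[of _ "(1/3) ^ k"] conjI ballI impI) auto
  qed
  show ?L
    unfolding openin_euclidean_subtopology_iff
    by (rule conjI[OF conjunct1[OF R]]) (rule ballI, rule ball)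
qed

lemma set_of_reals_enc_image: "set_of_reals (top_of_set (enc ` S))"
proof -
  have "separable_space (top_of_set (enc ` S))"
  proof -
    obtain T where "countable T" "T \<subseteq> enc ` S" "enc ` S \<subseteq> closure T"
      using separable[of "enc ` S"] .
    then have "top_of_set (enc ` S) closure_of T = enc ` S"
      by (auto simp: closure_of_subtopology Int_absorb1 Int_absorb2)
    with \<open>countable T\<close> \<open>T \<subseteq> enc ` S\<close> show ?thesis
      unfolding separable_space_def by auto
  qed
  moreover have "metrizable_space (top_of_set (enc ` S))"
    by (simp add: metrizable_space_subtopology metrizable_space_euclidean)
  moreover have "zero_dimensional_space (top_of_set (enc ` S))"
    unfolding zero_dimensional_space_def
  proof (intro allI impI, elim conjE)
    fix U u assume U: "openin (top_of_set (enc ` S)) U" and u: "u \<in> U"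
    have R: "U \<subseteq> enc ` S"
      "\<forall>x\<in>S. enc x \<in> U \<longrightarrow> (\<exists>k. \<forall>y\<in>S. y \<inter> {..<k} = x \<inter> {..<k} \<longrightarrow> enc y \<in> U)"
      using U unfolding openin_enc_image by auto
    then obtain x where x: "x \<in> S" "u = enc x" using u by blast
    have "enc x \<in> U" using x(2) u by simp
    with R(2) x(1) obtain k where k: "\<And>y. y \<in> S \<Longrightarrow> y \<inter> {..<k} = x \<inter> {..<k} \<Longrightarrow> enc y \<in> U"
      by metis
    let ?C = "enc ` {y\<in>S. y \<inter> {..<k} = x \<inter> {..<k}}"
    \<comment> \<open>A cylinder and its complement are both conditions on the trace below k, so
      openness for an arbitrary such condition makes the cylinder clopen.\<close>
    have cyl: "openin (top_of_set (enc ` S)) (enc ` {y\<in>S. P (y \<inter> {..<k})})" for P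
      unfolding openin_enc_image
    proof (intro conjI ballI impI)
      fix z assume z: "z \<in> S" "enc z \<in> enc ` {y\<in>S. P (y \<inter> {..<k})}"
      then have "P (z \<inter> {..<k})" by (auto simp: enc_inj)
      then show "\<exists>j. \<forall>y\<in>S. y \<inter> {..<j} = z \<inter> {..<j} \<longrightarrow> enc y \<in> enc ` {y\<in>S. P (y \<inter> {..<k})}"
        by (intro exI[of _ k]) auto
    qed auto
    have "openin (top_of_set (enc ` S)) ?C"
      using cyl[of "\<lambda>q. q = x \<inter> {..<k}"] .
    moreover have "closedin (top_of_set (enc ` S)) ?C"
    proof -
      have "enc ` S - ?C = enc ` (S - {y\<in>S. y \<inter> {..<k} = x \<inter> {..<k}})"
        by (rule image_set_diff[symmetric]) (simp add: inj_def enc_inj)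
      also have "S - {y\<in>S. y \<inter> {..<k} = x \<inter> {..<k}} = {y\<in>S. y \<inter> {..<k} \<noteq> x \<inter> {..<k}}"
        by blast
      finally have "openin (top_of_set (enc ` S)) (enc ` S - ?C)"
        using cyl[of "\<lambda>q. q \<noteq> x \<inter> {..<k}"] by (simp only:)
      moreover have "?C \<subseteq> enc ` S" by blast
      ultimately show ?thesis
        unfolding closedin_def by (simp only: topspace_euclidean_subtopology simp_thms)
    qed
    moreover have "u \<in> ?C" unfolding x(2) by (rule imageI) (simp add: x(1))
    moreover have "?C \<subseteq> U" by (rule image_subsetI) (simp add: k)
    ultimately show "\<exists>C. openin (top_of_set (enc ` S)) C \<and> closedin (top_of_set (enc ` S)) C \<and> u \<in> C \<and> C \<subseteq> U"
      by blast
  qed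
  ultimately show ?thesis unfolding set_of_reals_def by blast
qed

section \<open>Combinatorial criteria\<close>

text \<open>Some member of the n-th cover contains the codes of F' and of all subsets of
  \<open>{..<n}\<close>. By openness at these finitely many subsets it contains every point missing
  [n, m) for some m, and h F' n is such an m. A finite F is thus caught in two ways: F' outright, F
  - F' by missing the interval. The function G says how far into each enumeration to select.\<close>

lemma S_fin_omega_covers_enc_image:
  assumes fin: "\<And>x. finite x \<Longrightarrow> x \<in> S"
    and sel: "\<And>h :: nat set set \<Rightarrow> nat \<Rightarrow> nat. \<exists>G. \<forall>F. finite F \<and> F \<subseteq> S \<longrightarrow>
      (\<exists>F'\<subseteq>F. \<exists>n. h F' n \<le> G n \<and> (\<forall>x\<in>F - F'. x \<inter> {n..<h F' n} = {}))"
  shows "S_fin (omega_covers (top_of_set (enc ` S))) (omega_covers (top_of_set (enc ` S)))"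
  unfolding S_fin_def
proof (intro allI impI)
  fix \<U> :: "nat \<Rightarrow> real set set"
  assume \<U>: "\<forall>n. \<U> n \<in> omega_covers (top_of_set (enc ` S))"
  have opn: "openin (top_of_set (enc ` S)) U" if "U \<in> \<U> n" for U n
    using \<U> that unfolding omega_covers_def open_covers_def by blast
  have countable: "countable (\<U> n)" and proper: "enc ` S \<notin> \<U> n" for n
    using \<U> unfolding omega_covers_def by auto
  have omega: "\<exists>U\<in>\<U> n. F \<subseteq> U" if "finite F" "F \<subseteq> enc ` S" for F n
    using \<U> that unfolding omega_covers_def by auto
  have ne: "\<U> n \<noteq> {}" for n using omega[of "{}" n] by auto
  define e where "e n = from_nat_into (\<U> n)" for n
  have e: "range (e n) = \<U> n" for n
    unfolding e_def by (rule range_from_nat_into[OF ne countable])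
  have "\<exists>m. \<exists>j\<le>m. \<forall>x\<in>S. x \<in> F' \<or> x \<inter> {n..<m} = {} \<longrightarrow> enc x \<in> e n j"
    if F': "finite F'" "F' \<subseteq> S" for F' n
  proof -
    have "finite (enc ` (F' \<union> Pow {..<n}))" using F'(1) by auto
    moreover have "enc ` (F' \<union> Pow {..<n}) \<subseteq> enc ` S"
      using F'(2) fin finite_subset[of _ "{..<n}"] by auto
    ultimately obtain U where U: "U \<in> \<U> n" "enc ` (F' \<union> Pow {..<n}) \<subseteq> U"
      using omega by meson
    then obtain j where j: "U = e n j" using e by blast
    have "\<exists>k. \<forall>y\<in>S. y \<inter> {..<k} = q \<inter> {..<k} \<longrightarrow> enc y \<in> U" if q: "q \<in> Pow {..<n}" for q
    proof -
      have "q \<in> S" using q fin finite_subset[of q "{..<n}"] by auto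
      moreover have "enc q \<in> U" using U(2) q by blast
      ultimately show ?thesis using opn[OF U(1)] unfolding openin_enc_image by metis
    qed
    then obtain k where k: "\<And>q y. q \<in> Pow {..<n} \<Longrightarrow> y \<in> S \<Longrightarrow> y \<inter> {..<k q} = q \<inter> {..<k q} \<Longrightarrow> enc y \<in> U"
      by metis
    \<comment> \<open>The sum bounds all the moduli k q at once, and the summand j makes the same
      number bound the index of U in the enumeration.\<close>
    define m where "m = j + (\<Sum>q\<in>Pow {..<n}. k q)"
    have "enc x \<in> U" if x: "x \<in> S" "x \<inter> {n..<m} = {}" for x
    proof -
      let ?q = "x \<inter> {..<n}"
      have q: "?q \<in> Pow {..<n}" by blast
      have "k ?q \<le> (\<Sum>q\<in>Pow {..<n}. k q)"
        by (rule member_le_sum) (use q in auto)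
      then have "k ?q \<le> m" unfolding m_def by simp
      then have "x \<inter> {..<k ?q} = ?q \<inter> {..<k ?q}"
        using x(2) by fastforce
      then show ?thesis by (rule k[OF q x(1)])
    qed
    moreover have "enc x \<in> U" if "x \<in> F'" for x using U(2) that by blast
    moreover have "j \<le> m" unfolding m_def by simp
    ultimately show ?thesis unfolding j by blast
  qed
  then obtain h where h: "\<And>F' n. finite F' \<Longrightarrow> F' \<subseteq> S \<Longrightarrow>
      \<exists>j\<le>h F' n. \<forall>x\<in>S. x \<in> F' \<or> x \<inter> {n..<h F' n} = {} \<longrightarrow> enc x \<in> e n j"
    by metis
  from sel[of h] obtain G where G: "\<forall>F. finite F \<and> F \<subseteq> S \<longrightarrow>
      (\<exists>F'\<subseteq>F. \<exists>n. h F' n \<le> G n \<and> (\<forall>x\<in>F - F'. x \<inter> {n..<h F' n} = {}))" ..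
  define \<F> where "\<F> n = e n ` {..G n}" for n
  have sub: "finite (\<F> n)" "\<F> n \<subseteq> \<U> n" for n
    unfolding \<F>_def using e by auto
  have cover: "\<exists>U\<in>\<Union>n. \<F> n. F \<subseteq> U" if F: "finite F" "F \<subseteq> enc ` S" for F
  proof -
    from finite_subset_image[OF F] obtain F0 where F0: "F0 \<subseteq> S" "finite F0" "F = enc ` F0"
      by (elim exE conjE)
    have "\<exists>F'\<subseteq>F0. \<exists>n. h F' n \<le> G n \<and> (\<forall>x\<in>F0 - F'. x \<inter> {n..<h F' n} = {})"
      using G F0(1,2) by simp
    then obtain F' n where F': "F' \<subseteq> F0" "h F' n \<le> G n" "\<And>x. x \<in> F0 - F' \<Longrightarrow> x \<inter> {n..<h F' n} = {}"
      by metis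
    have "finite F'" "F' \<subseteq> S"
      using finite_subset[OF F'(1) F0(2)] F'(1) F0(1) by auto
    from h[OF this, of n] obtain j where j: "j \<le> h F' n"
        "\<And>x. x \<in> S \<Longrightarrow> x \<in> F' \<or> x \<inter> {n..<h F' n} = {} \<Longrightarrow> enc x \<in> e n j"
      by metis
    have "F \<subseteq> e n j"
      unfolding F0(3) using j(2) F'(3) F0(1) by blast
    moreover have "e n j \<in> \<F> n" unfolding \<F>_def using j(1) F'(2) by auto
    ultimately show ?thesis by blast
  qed
  have "\<Union> (\<Union>n. \<F> n) = enc ` S"
  proof
    show "\<Union> (\<Union>n. \<F> n) \<subseteq> enc ` S"
      using opn sub(2) openin_subset by fastforce
    show "enc ` S \<subseteq> \<Union> (\<Union>n. \<F> n)"
      using cover[of "{x}" for x] by blast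
  qed
  moreover have "countable (\<Union>n. \<F> n)"
    using sub(1) by (simp add: countable_finite)
  moreover have "\<And>U. U \<in> (\<Union>n. \<F> n) \<Longrightarrow> openin (top_of_set (enc ` S)) U"
    using opn sub(2) by blast
  moreover have "enc ` S \<notin> (\<Union>n. \<F> n)"
    using proper sub(2) by blast
  ultimately have "(\<Union>n. \<F> n) \<in> omega_covers (top_of_set (enc ` S))"
    unfolding omega_covers_def open_covers_def using cover by simp
  with sub show "\<exists>\<F>. (\<forall>n. finite (\<F> n) \<and> \<F> n \<subseteq> \<U> n) \<and> (\<Union>n. \<F> n) \<in> omega_covers (top_of_set (enc ` S))"
    by blast
qed

text \<open>The sets \<open>V n m\<close> increase with m, so a finite selection from the n-th cover
  amounts to one number g n. An interval [n, g n) inside s and disjoint from t puts t but not s into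
  the n-th union; if this happens infinitely often in both directions, the \<tau>-condition fails at
  s and t.\<close>

lemma not_U_fin_enc_image:
  assumes fin: "\<And>x. finite x \<Longrightarrow> x \<in> S"
    and coinf: "\<And>x. x \<in> S \<Longrightarrow> infinite (- x)"
    and split: "\<And>f :: nat \<Rightarrow> nat. \<exists>s\<in>S. \<exists>t\<in>S. s \<inter> t = {} \<and>
      (\<exists>\<^sub>F c in sequentially. {c..<f c} \<subseteq> s) \<and> (\<exists>\<^sub>F c in sequentially. {c..<f c} \<subseteq> t)"
  shows "\<not> U_fin (top_of_set (enc ` S)) (open_covers (top_of_set (enc ` S))) (tau_covers (top_of_set (enc ` S)))"
proof
  assume U: "U_fin (top_of_set (enc ` S)) (open_covers (top_of_set (enc ` S))) (tau_covers (top_of_set (enc ` S)))"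
  define V where "V n m = enc ` {x\<in>S. \<not> {n..<m} \<subseteq> x}" for n m :: nat
  have V: "enc x \<in> V n m \<longleftrightarrow> x \<in> S \<and> \<not> {n..<m} \<subseteq> x" for x n m
    unfolding V_def by (auto simp: enc_inj)
  have "V n ` {n<..} \<in> open_covers (top_of_set (enc ` S))" for n
  proof -
    have "openin (top_of_set (enc ` S)) (V n m)" for m
      unfolding openin_enc_image
    proof (intro conjI ballI impI)
      show "V n m \<subseteq> enc ` S" unfolding V_def by auto
      fix x assume "x \<in> S" "enc x \<in> V n m"
      then have "\<not> {n..<m} \<subseteq> x" by (simp add: V)
      then have "enc y \<in> V n m" if "y \<in> S" "y \<inter> {..<m} = x \<inter> {..<m}" for y
        using that unfolding V by fastforce
      then show "\<exists>k. \<forall>y\<in>S. y \<inter> {..<k} = x \<inter> {..<k} \<longrightarrow> enc y \<in> V n m" by blast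
    qed
    moreover have "\<exists>m>n. enc x \<in> V n m" if "x \<in> S" for x
    proof -
      have "infinite (- x)" using that by (rule coinf)
      then obtain i where "i \<ge> n" "i \<notin> x"
        unfolding infinite_nat_iff_unbounded_le by blast
      then show ?thesis using that by (intro exI[of _ "Suc i"]) (auto simp: V)
    qed
    then have "enc ` S \<subseteq> \<Union> (V n ` {n<..})" by blast
    moreover have "\<Union> (V n ` {n<..}) \<subseteq> enc ` S" unfolding V_def by blast
    ultimately show ?thesis unfolding open_covers_def by auto
  qed
  moreover have "\<not> (\<exists>\<V>. finite \<V> \<and> \<V> \<subseteq> V n ` {n<..} \<and> \<Union>\<V> = topspace (top_of_set (enc ` S)))" for n
  proof
    assume "\<exists>\<V>. finite \<V> \<and> \<V> \<subseteq> V n ` {n<..} \<and> \<Union>\<V> = topspace (top_of_set (enc ` S))"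
    then obtain \<V> where \<V>: "finite \<V>" "\<V> \<subseteq> V n ` {n<..}" "\<Union>\<V> = enc ` S" by auto
    then obtain M where M: "finite M" "\<V> = V n ` M" by (meson finite_subset_image)
    \<comment> \<open>The sum is at least each m in M, so this interval contains every
      \<open>{n..<m}\<close> and its code is in none of the chosen sets.\<close>
    have "{n..<\<Sum>M} \<in> S" using fin by simp
    then have "enc {n..<\<Sum>M} \<in> \<Union>\<V>" unfolding \<V>(3) by blast
    then obtain m where "m \<in> M" "enc {n..<\<Sum>M} \<in> V n m" unfolding M(2) by blast
    moreover have "m \<le> \<Sum>M"
      using member_le_sum[of m M "\<lambda>x. x"] M(1) \<open>m \<in> M\<close> by simp
    ultimately show False unfolding V by auto
  qed
  ultimately have "\<exists>\<F>. (\<forall>n. finite (\<F> n) \<and> \<F> n \<subseteq> V n ` {n<..}) \<and>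
      range (\<lambda>n. \<Union> (\<F> n)) \<in> tau_covers (top_of_set (enc ` S))"
    by (intro U[unfolded U_fin_def, rule_format] conjI)
  then obtain \<F> where \<F>: "\<And>n. finite (\<F> n)" "\<And>n. \<F> n \<subseteq> V n ` {n<..}"
      "range (\<lambda>n. \<Union> (\<F> n)) \<in> tau_covers (top_of_set (enc ` S))"
    by auto
  have "\<exists>g\<ge>n. \<Union> (\<F> n) = V n g" for n
  proof -
    obtain M where M: "M \<subseteq> {n<..}" "finite M" "\<F> n = V n ` M"
      using finite_subset_image[OF \<F>(1,2)] by metis
    show ?thesis
    proof (cases "M = {}")
      case True
      \<comment> \<open>An empty selection is recorded as g n = n: the empty interval lies in every
        set, so \<open>V n n\<close> is empty.\<close>
      then show ?thesis using M by (intro exI[of _ n]) (auto simp: V_def)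
    next
      case False
      have mono: "V n m \<subseteq> V n m'" if "m \<le> m'" for m m'
        unfolding V_def using that by fastforce
      have "\<Union> (V n ` M) = V n (Max M)"
        using mono Max_ge[OF M(2)] Max_in[OF M(2) False] by blast
      moreover have "Max M \<ge> n" using Max_in[OF M(2) False] M(1) by auto
      ultimately show ?thesis using M(3) by metis
    qed
  qed
  then obtain g where g: "\<And>n. n \<le> g n" "\<And>n. \<Union> (\<F> n) = V n (g n)" by metis
  define W where "W n = V n (g n)" for n
  have \<tau>: "range W \<in> tau_covers (top_of_set (enc ` S))"
    using \<F>(3) unfolding g(2) W_def .
  have W: "enc x \<in> W n \<longleftrightarrow> x \<in> S \<and> \<not> {n..<g n} \<subseteq> x" for x n
    unfolding W_def by (rule V)
  \<comment> \<open>The empty set belongs to infinitely many members, and only an n with n < g n can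
    give one; hence nondegenerate intervals never run out.\<close>
  have "{} \<in> S" using fin by simp
  then have "infinite {U \<in> range W. enc {} \<in> U}"
    using \<tau> unfolding tau_covers_def by simp
  moreover have "{U \<in> range W. enc {} \<in> U} \<subseteq> W ` {n. n < g n}"
    using W by auto
  ultimately have N: "infinite {n. n < g n}"
    by (meson finite_imageI finite_subset)
  \<comment> \<open>Used to feed the splitting hypothesis: [c, g (next_n c)) contains the
    nondegenerate interval of the cover that starts at \<open>next_n c\<close>.\<close>
  define next_n where "next_n c = (LEAST n. c \<le> n \<and> n < g n)" for c
  have next_n: "c \<le> next_n c" "next_n c < g (next_n c)" for c
  proof -
    obtain n where "c \<le> n \<and> n < g n" using N unfolding infinite_nat_iff_unbounded_le by blast
    then have "c \<le> next_n c \<and> next_n c < g (next_n c)" unfolding next_n_def by (rule LeastI)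
    then show "c \<le> next_n c" "next_n c < g (next_n c)" by auto
  qed
  have sep: "infinite {U \<in> range W. enc t \<in> U \<and> enc s \<notin> U}"
    if "s \<in> S" "t \<in> S" "s \<inter> t = {}" and freq: "\<exists>\<^sub>F c in sequentially. {c..<g (next_n c)} \<subseteq> s" for s t
  proof
    assume fin_sep: "finite {U \<in> range W. enc t \<in> U \<and> enc s \<notin> U}"
    define A where "A = {n. n < g n \<and> enc t \<in> W n \<and> enc s \<notin> W n}"
    have "\<exists>n\<ge>N. n \<in> A" for N
    proof -
      obtain c where c: "c \<ge> N" "{c..<g (next_n c)} \<subseteq> s"
        using freq unfolding frequently_sequentially by blast
      have *: "{next_n c..<g (next_n c)} \<subseteq> s" using c(2) next_n(1)[of c] by fastforce
      moreover have "next_n c \<in> {next_n c..<g (next_n c)}" using next_n(2)[of c] by simp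
      ultimately have "\<not> {next_n c..<g (next_n c)} \<subseteq> t" using that(3) by blast
      with * have "next_n c \<in> A" unfolding A_def W using that(1,2) next_n(2)[of c] by simp
      then show ?thesis using next_n(1)[of c] c(1) order_trans by blast
    qed
    \<comment> \<open>Infinitely many indices could still name finitely many sets, since covers are
      not indexed. Then one value \<open>W n0\<close> would recur at arbitrarily large n in A, but
      the code of [n0, g n0) is outside \<open>W n0\<close> and inside \<open>W n\<close> once n is
      at least g n0.\<close>
    then have "infinite A" unfolding infinite_nat_iff_unbounded_le by blast
    moreover have "W ` A \<subseteq> {U \<in> range W. enc t \<in> U \<and> enc s \<notin> U}" unfolding A_def by auto
    then have "finite (W ` A)" using fin_sep finite_subset by blast
    ultimately obtain n0 where n0: "n0 \<in> A" "infinite {n\<in>A. W n = W n0}"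
      using pigeonhole_infinite by blast
    let ?q = "{n0..<g n0}"
    have "?q \<in> S" using fin by simp
    obtain n where n: "n \<ge> g n0" "n \<in> A" "W n = W n0"
      using n0(2) unfolding infinite_nat_iff_unbounded_le by blast
    have "enc ?q \<in> W n" unfolding W using \<open>?q \<in> S\<close> n(1,2) unfolding A_def by auto
    moreover have "enc ?q \<notin> W n0" unfolding W by simp
    ultimately show False using n(3) by simp
  qed
  obtain s t where "s \<in> S" "t \<in> S" "s \<inter> t = {}" "\<exists>\<^sub>F c in sequentially. {c..<g (next_n c)} \<subseteq> s"
      "\<exists>\<^sub>F c in sequentially. {c..<g (next_n c)} \<subseteq> t"
    using split[of "\<lambda>c. g (next_n c)"] by blast
  then have "infinite {U \<in> range W. enc t \<in> U \<and> enc s \<notin> U}" "infinite {U \<in> range W. enc s \<in> U \<and> enc t \<notin> U}"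
    using sep[of s t] sep[of t s] by (auto simp: Int_commute)
  then show False
    using \<tau> \<open>s \<in> S\<close> \<open>t \<in> S\<close> unfolding tau_covers_def by auto
qed

section \<open>Dominating families of least cardinality\<close>

text \<open>Finite subsets are images of lists, and by induction the lists of each fixed length
  number at most |A|.\<close>

lemma card_of_Fpow_infinite:
  assumes "infinite A"
  shows "|Fpow A| \<le>o |A|"
proof -
  have lists: "|{xs. set xs \<subseteq> A \<and> length xs = n}| \<le>o |A|" for n
  proof (induction n)
    case 0
    have "A \<noteq> {}" using assms by auto
    then have "|{[]}| \<le>o |A|" by (rule card_of_singl_ordLeq)
    moreover have "{xs. set xs \<subseteq> A \<and> length xs = 0} = {[]}" by auto
    ultimately show ?case by (simp only:)
  next
    case (Suc n)
    let ?L = "{xs. set xs \<subseteq> A \<and> length xs = n}"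
    have "{xs. set xs \<subseteq> A \<and> length xs = Suc n} = (\<lambda>(x, xs). x # xs) ` (A \<times> ?L)"
      by (auto simp: length_Suc_conv)
    then have "|{xs. set xs \<subseteq> A \<and> length xs = Suc n}| \<le>o |A \<times> ?L|"
      by (simp only: card_of_image)
    also have "|A \<times> ?L| \<le>o |A|"
      by (rule card_of_Sigma_ordLeq_infinite[OF assms]) (simp_all add: Suc card_of_mono1)
    finally show ?case .
  qed
  have "|\<Union>n. {xs. set xs \<subseteq> A \<and> length xs = n}| \<le>o |A|"
    by (rule card_of_UNION_ordLeq_infinite[OF assms])
       (simp_all add: lists assms flip: infinite_iff_card_of_nat)
  moreover have "Fpow A \<subseteq> set ` (\<Union>n. {xs. set xs \<subseteq> A \<and> length xs = n})"
    by (force simp: Fpow_def dest: finite_list)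
  then have "|Fpow A| \<le>o |\<Union>n. {xs. set xs \<subseteq> A \<and> length xs = n}|"
    by (rule ordLeq_transitive[OF card_of_mono1 card_of_image])
  ultimately show ?thesis
    by (blast intro: ordLeq_transitive)
qed

definition dominating :: "(nat \<Rightarrow> nat) set \<Rightarrow> bool" where
  "dominating D \<longleftrightarrow> (\<forall>f. \<exists>d\<in>D. \<forall>\<^sub>F n in sequentially. f n \<le> d n)"

definition growing :: "(nat \<Rightarrow> nat) \<Rightarrow> bool" where
  "growing f \<longleftrightarrow> mono f \<and> (\<forall>n. n < f n)"

text \<open>The summand Suc n forces n < f n, and the partial sums force monotonicity.\<close>

definition majorant :: "(nat \<Rightarrow> nat) \<Rightarrow> nat \<Rightarrow> nat" where
  "majorant f n = Suc n + (\<Sum>i\<le>n. f i)"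

lemma majorant_growing: "growing (majorant f)"
  unfolding growing_def majorant_def by (auto intro!: monoI add_mono sum_mono2)

lemma le_majorant: "f n \<le> majorant f n"
  unfolding majorant_def using member_le_sum[of n "{..n}" f] by simp

lemma growingD: "growing f \<Longrightarrow> n < f n" "growing f \<Longrightarrow> m \<le> n \<Longrightarrow> f m \<le> f n"
  by (auto simp: growing_def monoD)

text \<open>The cardinality of such a family is the dominating number.\<close>

locale minimal_dominating =
  fixes D :: "(nat \<Rightarrow> nat) set"
  assumes dominating: "dominating D"
    and growing: "d \<in> D \<Longrightarrow> growing d"
    and minimal: "dominating E \<Longrightarrow> |D| \<le>o |E|"

text \<open>Cardinals are well-ordered, so a least dominating family exists; replacing its members
  by majorants keeps it dominating and cannot enlarge it.\<close>

lemma minimal_dominating_exists: "\<exists>D. minimal_dominating D"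
proof -
  have "dominating UNIV"
    unfolding dominating_def by (meson UNIV_I always_eventually order_refl)
  then obtain E where E: "dominating E" "\<And>E'. dominating E' \<Longrightarrow> |E| \<le>o |E'|"
    using exists_minim_Card_order[of "card_of ` Collect dominating"] card_of_Card_order by auto
  have "minimal_dominating (majorant ` E)"
  proof
    show "dominating (majorant ` E)"
      unfolding dominating_def
    proof
      fix f
      obtain d where "d \<in> E" "\<forall>\<^sub>F n in sequentially. f n \<le> d n"
        using E(1) unfolding dominating_def by blast
      then have "\<forall>\<^sub>F n in sequentially. f n \<le> majorant d n"
        by (auto elim!: eventually_mono intro: order_trans le_majorant)
      with \<open>d \<in> E\<close> show "\<exists>d\<in>majorant ` E. \<forall>\<^sub>F n in sequentially. f n \<le> d n"
        by blast
    qed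
    show "growing d" if "d \<in> majorant ` E" for d
      using that majorant_growing by auto
    show "|majorant ` E| \<le>o |E'|" if "dominating E'" for E'
      using E(2)[OF that] card_of_image ordLeq_transitive by blast
  qed
  then show ?thesis ..
qed

section \<open>Cardinalities below the dominating number\<close>

context minimal_dominating
begin

abbreviation small :: "'b set \<Rightarrow> bool" where
  "small I \<equiv> |I| <o |D|"

lemma small_image: "small I \<Longrightarrow> small (f ` I)"
  using card_of_image ordLeq_ordLess_trans by blast

lemma small_subset: "small I \<Longrightarrow> J \<subseteq> I \<Longrightarrow> small J"
  using card_of_mono1 ordLeq_ordLess_trans by blast

lemma not_small_dominating: "dominating E \<Longrightarrow> \<not> small E"
  using minimal not_ordLess_ordLeq by blast

text \<open>A small family is not dominating, so some f is infinitely often above each member; its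
  majorant is the growing g. This is how smallness yields one function serving many
  requirements.\<close>

lemma escape:
  assumes "small I"
  shows "\<exists>g. growing g \<and> (\<forall>i\<in>I. \<exists>\<^sub>F n in sequentially. \<psi> i n < g n)"
proof -
  have "\<not> dominating (\<psi> ` I)"
    using not_small_dominating small_image[OF assms] by blast
  then obtain f where f: "\<And>i. i \<in> I \<Longrightarrow> \<not> (\<forall>\<^sub>F n in sequentially. f n \<le> \<psi> i n)"
    unfolding dominating_def by auto
  show ?thesis
  proof (intro exI[of _ "majorant f"] conjI ballI majorant_growing)
    fix i assume "i \<in> I"
    from f[OF this] have "\<exists>\<^sub>F n in sequentially. \<psi> i n < f n"
      by (simp add: not_eventually not_le)
    then show "\<exists>\<^sub>F n in sequentially. \<psi> i n < majorant f n"
      by (rule frequently_elim1) (meson le_majorant less_le_trans)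
  qed
qed

text \<open>Diagonalization: a function eventually above every term of a sequence is obtained from
  the partial sums, so no sequence enumerates a dominating family.\<close>

lemma small_countable:
  assumes "countable I"
  shows "small I"
proof (rule ccontr)
  assume "\<not> small I"
  then have "|D| \<le>o |I|"
    using ordLess_or_ordLeq[OF card_of_Well_order card_of_Well_order] by blast
  then have "countable D"
    using assms by (meson card_of_ordLeq countable_image_inj_on countable_subset)
  moreover have "D \<noteq> {}" using dominating unfolding dominating_def by auto
  ultimately obtain e :: "nat \<Rightarrow> nat \<Rightarrow> nat" where e: "D = range e"
    using uncountable_def by blast
  obtain d where "d \<in> D" and d: "\<forall>\<^sub>F n in sequentially. Suc (\<Sum>i\<le>n. e i n) \<le> d n"
    using dominating unfolding dominating_def by meson
  then obtain j where "d = e j" using e by auto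
  with d obtain N where N: "\<And>n. n \<ge> N \<Longrightarrow> Suc (\<Sum>i\<le>n. e i n) \<le> e j n"
    unfolding eventually_sequentially by auto
  have "e j (max N j) \<le> (\<Sum>i\<le>max N j. e i (max N j))"
    by (rule member_le_sum) auto
  with N[of "max N j"] show False by simp
qed

lemma infinite_D: "infinite D"
  using small_countable[OF countable_finite, of D] ordLess_irreflexive by blast


lemma small_Un: "small I \<Longrightarrow> small J \<Longrightarrow> small (I \<union> J)"
  by (rule card_of_Un_ordLess_infinite[OF infinite_D])

lemma small_Times:
  assumes "small I" "small J"
  shows "small (I \<times> J)"
proof -
  \<comment> \<open>The copy of the naturals makes the bounding set infinite even if I and J are
    finite, so that the product law for infinite cardinals applies.\<close>
  let ?K = "(I <+> J) <+> (UNIV :: nat set)"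
  have K: "small ?K" "infinite ?K"
    by (intro card_of_Plus_ordLess_infinite[OF infinite_D] assms small_countable) simp_all
  have "|I| \<le>o |?K|" "|J| \<le>o |?K|"
    by (meson card_of_Plus1 card_of_Plus2 ordLeq_transitive)+
  then have "|I \<times> J| \<le>o |?K|"
    by (intro card_of_Sigma_ordLeq_infinite[OF K(2)] ballI)
  with K(1) show ?thesis using ordLeq_ordLess_trans by blast
qed

lemma small_Fpow:
  assumes "small I"
  shows "small (Fpow I)"
proof (cases "finite I")
  case True
  then have "finite (Fpow I)" by (simp add: Fpow_Pow_finite)
  then show ?thesis by (intro small_countable countable_finite)
next
  case False
  with assms show ?thesis using card_of_Fpow_infinite ordLeq_ordLess_trans by blast
qed

end

section \<open>Small finitely splitting families\<close>

lemma iterate_strict_mono: "growing b \<Longrightarrow> strict_mono (\<lambda>i. (b ^^ i) 0)"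
  by (simp add: strict_mono_Suc_iff growingD(1))

lemma iterate_cell:
  assumes "growing b"
  shows "\<exists>i. (b ^^ i) 0 \<le> n \<and> n < (b ^^ Suc i) 0"
proof (induction n)
  case 0
  show ?case using growingD(1)[OF assms, of 0] by (intro exI[of _ 0]) simp
next
  case (Suc n)
  then obtain i where i: "(b ^^ i) 0 \<le> n" "n < (b ^^ Suc i) 0" by blast
  show ?case
  proof (cases "Suc n < (b ^^ Suc i) 0")
    case True
    with i(1) show ?thesis by (intro exI[of _ i]) simp
  next
    case False
    with i(2) have "Suc n = (b ^^ Suc i) 0" by simp
    then show ?thesis
      using growingD(1)[OF assms, of "Suc n"] by (intro exI[of _ "Suc i"]) simp
  qed
qed

lemma iterate_cell_unique:
  assumes "growing b" "(b ^^ i) 0 \<le> n" "n < (b ^^ Suc i) 0" "(b ^^ j) 0 \<le> n" "n < (b ^^ Suc j) 0"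
  shows "i = j"
proof -
  have "\<not> i < j" if "n < (b ^^ Suc i) 0" "(b ^^ j) 0 \<le> n" for i j
  proof
    assume "i < j"
    then have "(b ^^ Suc i) 0 \<le> (b ^^ j) 0"
      using strict_mono_leD[OF iterate_strict_mono[OF assms(1)], of "Suc i" j] by simp
    with that show False by simp
  qed
  with assms show ?thesis by (meson linorder_neqE_nat)
qed

definition next_in :: "nat set \<Rightarrow> nat \<Rightarrow> nat" where
  "next_in E n = (LEAST k. k \<in> E \<and> n \<le> k)"

lemma next_in:
  assumes "infinite E"
  shows "next_in E n \<in> E" "n \<le> next_in E n"
proof -
  obtain k where "k \<in> E \<and> n \<le> k"
    using assms unfolding infinite_nat_iff_unbounded_le by blast
  then have "next_in E n \<in> E \<and> n \<le> next_in E n"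
    unfolding next_in_def by (rule LeastI)
  then show "next_in E n \<in> E" "n \<le> next_in E n" by auto
qed

lemma next_in_mono:
  assumes "infinite E" "m \<le> n"
  shows "next_in E m \<le> next_in E n"
  unfolding next_in_def[of E m]
  by (rule Least_le) (use next_in[OF assms(1), of n] assms(2) in auto)

text \<open>Block-splitting of interval partitions in another form: for f large enough every [c, f
  c) contains a block of a given partition, and for long enough blocks every block contains some [c,
  f c).\<close>

definition finitely_splitting :: "nat set set \<Rightarrow> bool" where
  "finitely_splitting Y \<longleftrightarrow>
     (\<forall>f. \<exists>y\<in>Y. (\<exists>\<^sub>F c in sequentially. {c..<f c} \<subseteq> y) \<and>
                 (\<exists>\<^sub>F c in sequentially. {c..<f c} \<inter> y = {}))"

definition block :: "(nat \<Rightarrow> nat) \<Rightarrow> nat set \<Rightarrow> nat set" where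
  "block b y = (\<Union>i\<in>y. {(b ^^ i) 0..<(b ^^ Suc i) 0})"

lemma block_mono: "y \<subseteq> z \<Longrightarrow> block b y \<subseteq> block b z"
  unfolding block_def by blast

lemma mem_block:
  assumes "growing b" "(b ^^ i) 0 \<le> n" "n < (b ^^ Suc i) 0"
  shows "n \<in> block b y \<longleftrightarrow> i \<in> y"
  unfolding block_def UN_iff atLeastLessThan_iff
  using iterate_cell_unique[OF assms] assms(2,3) by metis

text \<open>The i-th cell starts at or beyond i, so infinitely many good cells give intervals
  arbitrarily far out; cells are disjoint, so an interval in a cell of y avoids the cells of the
  complement.\<close>

lemma frequently_block:
  assumes b: "growing b" and f: "growing f" and y: "infinite y"
    and K: "\<And>i. i \<in> y \<Longrightarrow> \<exists>c. {c..<f c} \<subseteq> {(b ^^ i) 0..<(b ^^ Suc i) 0}"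
  shows "\<exists>\<^sub>F c in sequentially. {c..<f c} \<subseteq> block b y"
    and "\<exists>\<^sub>F c in sequentially. {c..<f c} \<inter> block b (- y) = {}"
proof -
  have "\<exists>c\<ge>N. {c..<f c} \<subseteq> block b y \<and> {c..<f c} \<inter> block b (- y) = {}" for N
  proof -
    obtain i where i: "i \<ge> N" "i \<in> y"
      using y unfolding infinite_nat_iff_unbounded_le by blast
    then obtain c where c: "{c..<f c} \<subseteq> {(b ^^ i) 0..<(b ^^ Suc i) 0}" using K by blast
    have "c \<in> {c..<f c}" using growingD(1)[OF f] by simp
    with c have "(b ^^ i) 0 \<le> c" by auto
    moreover have "i \<le> (b ^^ i) 0"
      using strict_mono_imp_increasing[OF iterate_strict_mono[OF b]] .
    ultimately have "N \<le> c" using i(1) by simp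
    moreover have "n \<in> block b y \<and> n \<notin> block b (- y)" if "n \<in> {c..<f c}" for n
      using mem_block[OF b, of i n] that c i(2) by auto
    ultimately show ?thesis by blast
  qed
  then show "\<exists>\<^sub>F c in sequentially. {c..<f c} \<subseteq> block b y"
    and "\<exists>\<^sub>F c in sequentially. {c..<f c} \<inter> block b (- y) = {}"
    unfolding frequently_sequentially by blast+
qed

text \<open>Let n lie in a cell with right end e. If f n is at most e, then [n, f n) fits in the
  cell. Otherwise f e \<le> f (f n) < b n \<le> b e, so [e, f e) fits in the next cell; the double
  application of f pays for this crossing.\<close>

lemma infinite_cells_above:
  assumes b: "growing b" and f: "growing f" and freq: "\<exists>\<^sub>F n in sequentially. f (f n) < b n"
  shows "infinite {i. \<exists>c. {c..<f c} \<subseteq> {(b ^^ i) 0..<(b ^^ Suc i) 0}}"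
  unfolding infinite_nat_iff_unbounded_le
proof
  fix N
  obtain n where n: "n \<ge> (b ^^ N) 0" "f (f n) < b n"
    using freq unfolding frequently_sequentially by blast
  obtain i where i: "(b ^^ i) 0 \<le> n" "n < (b ^^ Suc i) 0"
    using iterate_cell[OF b] by blast
  have "N \<le> i"
  proof (rule ccontr)
    assume "\<not> N \<le> i"
    then have "(b ^^ Suc i) 0 \<le> (b ^^ N) 0"
      using strict_mono_leD[OF iterate_strict_mono[OF b], of "Suc i" N] by simp
    with i(2) n(1) show False by simp
  qed
  show "\<exists>j\<ge>N. j \<in> {i. \<exists>c. {c..<f c} \<subseteq> {(b ^^ i) 0..<(b ^^ Suc i) 0}}"
  proof (cases "f n \<le> (b ^^ Suc i) 0")
    case True
    then have "{n..<f n} \<subseteq> {(b ^^ i) 0..<(b ^^ Suc i) 0}" using i(1) by auto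
    with \<open>N \<le> i\<close> show ?thesis by blast
  next
    case False
    let ?c = "(b ^^ Suc i) 0"
    have "f ?c \<le> f (f n)" using False by (intro growingD(2)[OF f]) simp
    also have "\<dots> < b n" by (rule n(2))
    also have "\<dots> \<le> b ?c" using i(2) by (intro growingD(2)[OF b]) simp
    finally have "{?c..<f ?c} \<subseteq> {?c..<(b ^^ Suc (Suc i)) 0}" by auto
    then have "Suc i \<in> {i. \<exists>c. {c..<f c} \<subseteq> {(b ^^ i) 0..<(b ^^ Suc i) 0}}" by blast
    then show ?thesis using le_SucI[OF \<open>N \<le> i\<close>] by blast
  qed
qed

section \<open>Unsplit infinite sets and the regularity argument\<close>

context minimal_dominating
begin

text \<open>The unions of blocks coded by T and Y form a small family, hence fail to split finitely
  at some f0. For a suitable t, infinitely many cells of the partition by g t contain an interval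
  [c, f c); K is the set of their indices. A y splitting K would make \<open>block (g t) y\<close>
  split at f0.\<close>

lemma reaping_set:
  assumes no: "\<And>Y. small Y \<Longrightarrow> \<not> finitely_splitting Y"
    and T: "small T" and g: "\<And>t. t \<in> T \<Longrightarrow> growing (g t)"
    and unbounded: "\<And>f. \<exists>t\<in>T. \<exists>\<^sub>F n in sequentially. f n < g t n"
    and Y: "small (Y :: nat set set)"
  shows "\<exists>K. infinite K \<and> (\<forall>y\<in>Y. finite (K \<inter> y) \<or> finite (K - y))"
proof -
  have "small ((\<lambda>(t, y). block (g t) y) ` (T \<times> Y))"
    by (rule small_image[OF small_Times[OF T Y]])
  from no[OF this] obtain f0 where f0: "\<And>t y. t \<in> T \<Longrightarrow> y \<in> Y \<Longrightarrow>
      \<not> ((\<exists>\<^sub>F c in sequentially. {c..<f0 c} \<subseteq> block (g t) y) \<and>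
         (\<exists>\<^sub>F c in sequentially. {c..<f0 c} \<inter> block (g t) y = {}))"
    unfolding finitely_splitting_def by fastforce
  define f where "f = majorant f0"
  have f: "growing f" unfolding f_def by (rule majorant_growing)
  have sub: "{c..<f0 c} \<subseteq> {c..<f c}" for c
    using le_majorant[of f0 c] unfolding f_def by auto
  obtain t where t: "t \<in> T" "\<exists>\<^sub>F n in sequentially. f (f n) < g t n"
    using unbounded[of "\<lambda>n. f (f n)"] by blast
  define K where "K = {i. \<exists>c. {c..<f c} \<subseteq> {(g t ^^ i) 0..<(g t ^^ Suc i) 0}}"
  have "infinite K"
    unfolding K_def by (rule infinite_cells_above[OF g[OF t(1)] f t(2)])
  moreover have "finite (K \<inter> y) \<or> finite (K - y)" if "y \<in> Y" for y
  proof (rule ccontr)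
    assume "\<not> (finite (K \<inter> y) \<or> finite (K - y))"
    then have inf: "infinite (K \<inter> y)" "infinite (K - y)" by auto
    have cell: "\<exists>c. {c..<f c} \<subseteq> {(g t ^^ i) 0..<(g t ^^ Suc i) 0}" if "i \<in> K" for i
      using that unfolding K_def by blast
    have "\<exists>\<^sub>F c in sequentially. {c..<f c} \<subseteq> block (g t) (K \<inter> y)"
      by (rule frequently_block(1)[OF g[OF t(1)] f inf(1)]) (use cell in blast)
    then have "\<exists>\<^sub>F c in sequentially. {c..<f0 c} \<subseteq> block (g t) y"
      by (rule frequently_elim1) (use sub block_mono[of "K \<inter> y" y] in blast)
    moreover have "\<exists>\<^sub>F c in sequentially. {c..<f c} \<inter> block (g t) (- (K - y)) = {}"
      by (rule frequently_block(2)[OF g[OF t(1)] f inf(2)]) (use cell in blast)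
    then have "\<exists>\<^sub>F c in sequentially. {c..<f0 c} \<inter> block (g t) y = {}"
    proof (rule frequently_elim1)
      fix c assume "{c..<f c} \<inter> block (g t) (- (K - y)) = {}"
      moreover have "block (g t) y \<subseteq> block (g t) (- (K - y))" by (rule block_mono) blast
      ultimately show "{c..<f0 c} \<inter> block (g t) y = {}" using sub[of c] by blast
    qed
    ultimately show False using f0[OF t(1) that] by blast
  qed
  ultimately show ?thesis by blast
qed

lemma small_finitely_splitting:
  assumes T: "small T" and E: "\<And>t. t \<in> T \<Longrightarrow> small (E t)" and D: "D \<subseteq> (\<Union>t\<in>T. E t)"
  shows "\<exists>Y. small Y \<and> finitely_splitting Y"
proof (rule ccontr)
  assume "\<nexists>Y. small Y \<and> finitely_splitting Y"
  then have no: "\<And>Y. small Y \<Longrightarrow> \<not> finitely_splitting Y" by blast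
  have "\<exists>g. growing g \<and> (\<forall>d\<in>E t. \<exists>\<^sub>F n in sequentially. d n < g n)" if "t \<in> T" for t
    using escape[OF E[OF that], of "\<lambda>d. d"] .
  then obtain g where g: "\<And>t. t \<in> T \<Longrightarrow> growing (g t)"
      "\<And>t d. t \<in> T \<Longrightarrow> d \<in> E t \<Longrightarrow> \<exists>\<^sub>F n in sequentially. d n < g t n"
    by metis
  \<comment> \<open>The functions g t, one escaping each piece, form the unbounded family: f is
    eventually below some d in a piece E t, and g t is infinitely often above d.\<close>
  have unbounded: "\<exists>t\<in>T. \<exists>\<^sub>F n in sequentially. f n < g t n" for f
  proof -
    obtain d where d: "d \<in> D" "\<forall>\<^sub>F n in sequentially. f n \<le> d n"
      using dominating unfolding dominating_def by blast
    then obtain t where t: "t \<in> T" "d \<in> E t" using D by blast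
    have "\<exists>\<^sub>F n in sequentially. f n < g t n"
      using frequently_eventually_frequently[OF g(2)[OF t] d(2)]
      by (rule frequently_elim1) simp
    with t(1) show ?thesis by blast
  qed
  have "\<exists>K. infinite K \<and> (\<forall>d\<in>E t. \<forall>s\<in>T. finite (K \<inter> {n. d n \<le> g s n}) \<or> finite (K - {n. d n \<le> g s n}))"
    if "t \<in> T" for t
  proof -
    have "small ((\<lambda>(d, s). {n. d n \<le> g s n}) ` (E t \<times> T))"
      by (rule small_image[OF small_Times[OF E[OF that] T]])
    from reaping_set[OF no T g(1) unbounded this] show ?thesis by fastforce
  qed
  then obtain K where K: "\<And>t. t \<in> T \<Longrightarrow> infinite (K t)"
      "\<And>t d s. t \<in> T \<Longrightarrow> d \<in> E t \<Longrightarrow> s \<in> T \<Longrightarrow>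
        finite (K t \<inter> {n. d n \<le> g s n}) \<or> finite (K t - {n. d n \<le> g s n})"
    by metis
  \<comment> \<open>This family is indexed by pairs from T, hence small, so its domination
    contradicts the minimality of D.\<close>
  have "dominating ((\<lambda>(s, t) n. g s (next_in (K t) n)) ` (T \<times> T))"
    unfolding dominating_def
  proof
    fix f
    obtain d where d: "d \<in> D" "\<forall>\<^sub>F n in sequentially. f n \<le> d n"
      using dominating unfolding dominating_def by blast
    then obtain t where t: "t \<in> T" "d \<in> E t" using D by blast
    note nxt = next_in[OF K(1)[OF t(1)]]
    \<comment> \<open>Taking s against d evaluated at the next element of K t gives d \<le> g s at
      infinitely many points of K t, as g s is monotone. Since K t is not split by this comparison,
      it then holds at all but finitely many of its points.\<close>
    obtain s where s: "s \<in> T" "\<exists>\<^sub>F n in sequentially. d (next_in (K t) n) < g s n"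
      using unbounded[of "\<lambda>n. d (next_in (K t) n)"] by blast
    have "\<exists>k\<ge>N. k \<in> K t \<inter> {n. d n \<le> g s n}" for N
    proof -
      obtain n where n: "n \<ge> N" "d (next_in (K t) n) < g s n"
        using s(2) unfolding frequently_sequentially by blast
      have "g s n \<le> g s (next_in (K t) n)" using nxt(2) by (rule growingD(2)[OF g(1)[OF s(1)]])
      with n nxt[of n] show ?thesis by (intro exI[of _ "next_in (K t) n"]) simp
    qed
    then have "infinite (K t \<inter> {n. d n \<le> g s n})"
      unfolding infinite_nat_iff_unbounded_le by blast
    then have "finite (K t - {n. d n \<le> g s n})" using K(2)[OF t s(1)] by blast
    then obtain N where N: "\<And>k. k \<in> K t \<Longrightarrow> \<not> d k \<le> g s k \<Longrightarrow> k < N"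
      using finite_nat_set_iff_bounded by auto
    have le: "f n \<le> g s (next_in (K t) n)" if "f n \<le> d n" "n \<ge> N" for n
    proof -
      have "d n \<le> d (next_in (K t) n)"
        using nxt(2) by (rule growingD(2)[OF growing[OF d(1)]])
      also have "\<dots> \<le> g s (next_in (K t) n)"
        using N[OF nxt(1)[of n]] nxt(2)[of n] that(2) by linarith
      finally show ?thesis using that(1) by simp
    qed
    with d(2) eventually_ge_at_top[of N]
    have "\<forall>\<^sub>F n in sequentially. f n \<le> g s (next_in (K t) n)"
      by (rule eventually_elim2) (blast intro: le)
    then show "\<exists>e\<in>(\<lambda>(s, t) n. g s (next_in (K t) n)) ` (T \<times> T). \<forall>\<^sub>F n in sequentially. f n \<le> e n"
      using s(1) t(1) by (intro bexI[of _ "\<lambda>n. g s (next_in (K t) n)"]) auto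
  qed
  moreover have "small ((\<lambda>(s, t) n. g s (next_in (K t) n)) ` (T \<times> T))"
    by (rule small_image[OF small_Times[OF T T]])
  ultimately show False using not_small_dominating by blast
qed

end

section \<open>Sparse pairs along a well-order\<close>

definition misses :: "nat set \<times> nat set \<Rightarrow> (nat \<Rightarrow> nat) \<Rightarrow> nat \<Rightarrow> bool" where
  "misses q b n \<longleftrightarrow> (fst q \<union> snd q) \<inter> {n..<b n} = {}"

text \<open>Such a pair supplies the s and t of \<open>not_U_fin_enc_image\<close> for every f
  eventually below a.\<close>

definition big_pair :: "(nat \<Rightarrow> nat) \<Rightarrow> nat set \<times> nat set \<Rightarrow> bool" where
  "big_pair a q \<longleftrightarrow> fst q \<inter> snd q = {} \<and>
    (\<exists>\<^sub>F c in sequentially. {c..<a c} \<subseteq> fst q) \<and> (\<exists>\<^sub>F c in sequentially. {c..<a c} \<subseteq> snd q)"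

context minimal_dominating
begin

text \<open>The sets are unions of blocks \<open>[c k, p (c k))\<close> along a sequence \<open>c\<close> that grows too fast
  for the few functions determined by the constraints; hence some gap is long enough.\<close>

lemma sparse_pair_exists:
  assumes p: "growing p" and I: "small I"
    and b: "\<And>i. i \<in> I \<Longrightarrow> growing (b i)" and E: "\<And>i. i \<in> I \<Longrightarrow> infinite (E i)"
  shows "\<exists>s t. s \<inter> t = {} \<and>
    (\<exists>\<^sub>F c in sequentially. {c..<p c} \<subseteq> s) \<and> (\<exists>\<^sub>F c in sequentially. {c..<p c} \<subseteq> t) \<and>
    (\<forall>i\<in>I. \<exists>\<^sub>F n in sequentially. n \<in> E i \<and> (s \<union> t) \<inter> {n..<b i n} = {})"
proof -
  \<comment> \<open>From n go past the block [n, p n), on to the next point of E i, and to the end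
    of the interval to be kept free there. Beating \<psi> i applied twice allows for a gap that ends
    too early, as in \<open>infinite_cells_above\<close>.\<close>
  define \<psi> where "\<psi> i n = b i (next_in (E i) (p n))" for i n
  obtain g where g: "growing g" "\<And>i. i \<in> I \<Longrightarrow> \<exists>\<^sub>F n in sequentially. \<psi> i (\<psi> i n) < g n"
    using escape[OF I, of "\<lambda>i n. \<psi> i (\<psi> i n)"] by blast
  \<comment> \<open>The summand p leaves room for the block [c k, p (c k)) before c (Suc k); the
    summand g provides the length of the gap behind it.\<close>
  define \<phi> where "\<phi> n = p n + g n" for n
  have \<phi>: "growing \<phi>"
    using growingD[OF p] growingD[OF g(1)] unfolding growing_def \<phi>_def
    by (auto intro!: monoI add_mono trans_less_add1)
  define c where "c k = (\<phi> ^^ k) 0" for k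
  have c_mono: "strict_mono c"
    unfolding c_def by (rule iterate_strict_mono[OF \<phi>])
  have c_Suc: "c (Suc k) = \<phi> (c k)" for k unfolding c_def by simp
  have pc: "p (c k) \<le> c (Suc k)" for k unfolding c_Suc \<phi>_def by simp
  define w where "w K = (\<Union>k\<in>K. {c k..<p (c k)})" for K
  have unique: "j = k" if "c j \<le> x" "x < p (c j)" "c k \<le> x" "x < c (Suc k)" for j k x
  proof -
    have "c j < c (Suc k)" "c k < c (Suc j)" using that pc[of j] by linarith+
    then have "j < Suc k" "k < Suc j" using strict_mono_less[OF c_mono] by blast+
    then show ?thesis by simp
  qed
  have gap: "x \<notin> w K" if "p (c k) \<le> x" "x < c (Suc k)" for x k K
  proof
    assume "x \<in> w K"
    then obtain j where j: "c j \<le> x" "x < p (c j)" unfolding w_def by auto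
    have "c k \<le> x" using that(1) growingD(1)[OF p, of "c k"] by simp
    from unique[OF j this that(2)] j(2) that(1) show False by simp
  qed
  have freq: "\<exists>\<^sub>F x in sequentially. {x..<p x} \<subseteq> w K" if "infinite K" for K
    unfolding frequently_sequentially
  proof
    fix N
    obtain k where "k \<ge> N" "k \<in> K"
      using \<open>infinite K\<close> unfolding infinite_nat_iff_unbounded_le by blast
    moreover have "k \<le> c k" by (rule strict_mono_imp_increasing[OF c_mono])
    ultimately show "\<exists>x\<ge>N. {x..<p x} \<subseteq> w K"
      unfolding w_def by (intro exI[of _ "c k"]) auto
  qed
  \<comment> \<open>Even and odd blocks form the two disjoint sets; the gaps are free of
    both.\<close>
  have "infinite {k :: nat. even k}" "infinite {k :: nat. odd k}"
    unfolding infinite_nat_iff_unbounded_le mem_Collect_eq by presburger+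
  note freq_even = freq[OF this(1)] and freq_odd = freq[OF this(2)]
  have "w {k. even k} \<inter> w {k. odd k} = {}"
  proof (rule ccontr)
    assume "w {k. even k} \<inter> w {k. odd k} \<noteq> {}"
    then obtain x j k where "even j" "c j \<le> x" "x < p (c j)" "odd k" "c k \<le> x" "x < p (c k)"
      unfolding w_def by auto
    moreover from this have "j = k" using unique pc[of k] less_le_trans by blast
    ultimately show False by simp
  qed
  moreover have "\<exists>\<^sub>F n in sequentially. n \<in> E i \<and> (w {k. even k} \<union> w {k. odd k}) \<inter> {n..<b i n} = {}"
    if i: "i \<in> I" for i
    unfolding frequently_sequentially
  proof
    fix N
    obtain n where n: "n \<ge> N" "\<psi> i (\<psi> i n) < \<phi> n"
      using g(2)[OF i] unfolding frequently_sequentially \<phi>_def by (meson trans_less_add2)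
    obtain k where k: "c k \<le> n" "n < c (Suc k)"
      using iterate_cell[OF \<phi>, of n] unfolding c_def by blast
    have \<psi>_mono: "\<psi> i u \<le> \<psi> i v" if "u \<le> v" for u v
      unfolding \<psi>_def using that
      by (intro growingD(2)[OF b[OF i]] next_in_mono[OF E[OF i]] growingD(2)[OF p])
    \<comment> \<open>A gap [p (c l), c (Suc l)) that starts by p u and reaches \<psi> i u contains
      the first point of E i from p u on, together with its required interval.\<close>
    have hit: "\<exists>m\<ge>N. m \<in> E i \<and> (w {k. even k} \<union> w {k. odd k}) \<inter> {m..<b i m} = {}"
      if "p (c l) \<le> p u" "\<psi> i u \<le> c (Suc l)" "N \<le> u" for l u
    proof (intro exI conjI)
      let ?m = "next_in (E i) (p u)"
      show "?m \<in> E i" by (rule next_in(1)[OF E[OF i]])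
      have m: "p u \<le> ?m" by (rule next_in(2)[OF E[OF i]])
      then show "?m \<ge> N" using that(3) growingD(1)[OF p, of u] by linarith
      have "x \<notin> w K" if "x \<in> {?m..<b i ?m}" for x K
        using gap[of l x K] that m \<open>p (c l) \<le> p u\<close> \<open>\<psi> i u \<le> c (Suc l)\<close> unfolding \<psi>_def by simp
      then show "(w {k. even k} \<union> w {k. odd k}) \<inter> {?m..<b i ?m} = {}" by blast
    qed
    \<comment> \<open>Either the gap behind block k reaches \<psi> i n, or c (Suc k) lies below
      \<psi> i n, and then \<psi> i (c (Suc k)) \<le> \<phi> n shows that the following gap is long
      enough.\<close>
    show "\<exists>m\<ge>N. m \<in> E i \<and> (w {k. even k} \<union> w {k. odd k}) \<inter> {m..<b i m} = {}"
    proof (cases "\<psi> i n \<le> c (Suc k)")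
      case True
      show ?thesis by (rule hit[OF growingD(2)[OF p k(1)] True n(1)])
    next
      case False
      have "\<psi> i (c (Suc k)) \<le> \<psi> i (\<psi> i n)" using False by (intro \<psi>_mono) simp
      also have "\<dots> \<le> \<phi> n" using n(2) by simp
      also have "\<dots> \<le> c (Suc (Suc k))"
        unfolding c_Suc[of "Suc k"] using k(2) by (intro growingD(2)[OF \<phi>]) simp
      finally show ?thesis using k(2) n(1) by (intro hit[of "Suc k" "c (Suc k)"]) simp_all
    qed
  qed
  ultimately show ?thesis using freq_even freq_odd by blast
qed

text \<open>The strict part of a well-order of least type, so that every proper initial segment is
  small.\<close>

definition less_D :: "(nat \<Rightarrow> nat) rel" where
  "less_D = |D| - Id"

lemma
  shows wf_less_D: "wf less_D"
    and trans_less_D: "(a, b) \<in> less_D \<Longrightarrow> (b, c) \<in> less_D \<Longrightarrow> (a, c) \<in> less_D"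
    and less_D_in: "(a, b) \<in> less_D \<Longrightarrow> a \<in> D \<and> b \<in> D"
    and less_D_total: "a \<in> D \<Longrightarrow> b \<in> D \<Longrightarrow> a \<noteq> b \<Longrightarrow> (a, b) \<in> less_D \<or> (b, a) \<in> less_D"
proof -
  have wo: "well_order_on D |D|" by (rule card_of_well_order_on)
  then show "wf less_D" unfolding less_D_def well_order_on_def by simp
  show "(a, c) \<in> less_D" if "(a, b) \<in> less_D" "(b, c) \<in> less_D"
    using that wo unfolding less_D_def order_on_defs
    by (metis DiffD1 DiffD2 DiffI IdI antisymD pair_in_Id_conv transD)
  show "a \<in> D \<and> b \<in> D" if "(a, b) \<in> less_D"
    using that Field_card_of[of D] unfolding less_D_def Field_def by auto
  show "(a, b) \<in> less_D \<or> (b, a) \<in> less_D" if "a \<in> D" "b \<in> D" "a \<noteq> b"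
    using that wo unfolding less_D_def order_on_defs total_on_def by auto
qed

lemma small_below:
  assumes "a \<in> D"
  shows "small {b. (b, a) \<in> less_D}"
proof -
  have "small (underS |D| a)"
    using card_of_underS[OF card_of_Card_order] assms by (simp add: Field_card_of)
  moreover have "{b. (b, a) \<in> less_D} = underS |D| a"
    unfolding less_D_def underS_def by auto
  ultimately show ?thesis by simp
qed

lemma maximal_in_finite:
  assumes "finite A" "A \<noteq> {}" "A \<subseteq> D"
  shows "\<exists>m\<in>A. \<forall>a\<in>A. a = m \<or> (a, m) \<in> less_D"
  using assms
proof (induction A rule: finite_ne_induct)
  case (insert x A)
  then obtain m where m: "m \<in> A" "\<forall>a\<in>A. a = m \<or> (a, m) \<in> less_D" by auto
  show ?case
  proof (cases "x = m \<or> (x, m) \<in> less_D")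
    case True
    with m show ?thesis by auto
  next
    case False
    then have "(m, x) \<in> less_D" using less_D_total[of x m] insert.prems m(1) by auto
    with m(2) show ?thesis using trans_less_D by (intro bexI[of _ x]) auto
  qed
qed simp

text \<open>Well-founded recursion. At a, a requirement consists of an earlier b and a finite set A
  of earlier indices whose pairs jointly miss [n, b n) infinitely often; the new pair must join them
  infinitely often. These requirements are fewer than \<delta>, so \<open>sparse_pair_exists\<close>
  meets them all.\<close>

lemma sparse_family_exists:
  "\<exists>q. (\<forall>a\<in>D. big_pair a (q a)) \<and>
    (\<forall>b A. finite A \<longrightarrow> (\<forall>a\<in>A. (b, a) \<in> less_D) \<longrightarrow>
      (\<exists>\<^sub>F n in sequentially. \<forall>a\<in>A. misses (q a) b n))"
proof -
  let ?I = "\<lambda>a. {b. (b, a) \<in> less_D}"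
  define P where "P q a r \<longleftrightarrow> (a \<in> D \<longrightarrow> big_pair a r \<and>
      (\<forall>b\<in>?I a. \<forall>A\<in>Fpow (?I a). (\<exists>\<^sub>F n in sequentially. \<forall>a'\<in>A. misses (q a') b n) \<longrightarrow>
        (\<exists>\<^sub>F n in sequentially. (\<forall>a'\<in>A. misses (q a') b n) \<and> misses r b n)))" for q a r
  have "\<exists>q. \<forall>a. P q a (q a)"
  proof (rule dependent_wf_choice[OF wf_less_D])
    \<comment> \<open>The recursion principle asks that the requirement at a depend on q only below
      a.\<close>
    fix q q' :: "(nat \<Rightarrow> nat) \<Rightarrow> nat set \<times> nat set" and a r
    assume "\<And>z. (z, a) \<in> less_D \<Longrightarrow> q z = q' z"
    then have "(\<lambda>n. \<forall>a'\<in>A. misses (q a') b n) = (\<lambda>n. \<forall>a'\<in>A. misses (q' a') b n)"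
      if "A \<in> Fpow (?I a)" for A b
      using that unfolding Fpow_def by (intro ext ball_cong) auto
    note eq = this fun_cong[OF this]
    show "P q a r = P q' a r"
      unfolding P_def by (simp add: eq cong: ball_cong)
  next
    fix a and q :: "(nat \<Rightarrow> nat) \<Rightarrow> nat set \<times> nat set"
    show "\<exists>r. P q a r"
    proof (cases "a \<in> D")
      case True
      define J where "J = {(b, A) \<in> ?I a \<times> Fpow (?I a). \<exists>\<^sub>F n in sequentially. \<forall>a'\<in>A. misses (q a') b n}"
      have "small (?I a \<times> Fpow (?I a))"
        by (intro small_Times small_Fpow small_below True)
      then have J: "small J" by (rule small_subset) (auto simp: J_def)
      have gr: "growing (fst i)" if "i \<in> J" for i
        using that less_D_in growing unfolding J_def by auto
      have inf: "infinite {n. \<forall>a'\<in>snd i. misses (q a') (fst i) n}" if "i \<in> J" for i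
        using that unfolding J_def by (auto simp: frequently_sequentially infinite_nat_iff_unbounded_le)
      have "\<exists>s t. s \<inter> t = {} \<and>
        (\<exists>\<^sub>F c in sequentially. {c..<a c} \<subseteq> s) \<and> (\<exists>\<^sub>F c in sequentially. {c..<a c} \<subseteq> t) \<and>
        (\<forall>i\<in>J. \<exists>\<^sub>F n in sequentially. n \<in> {n. \<forall>a'\<in>snd i. misses (q a') (fst i) n} \<and>
          (s \<union> t) \<inter> {n..<fst i n} = {})"
        by (rule sparse_pair_exists[OF growing[OF True] J gr inf])
      then obtain s t where st: "s \<inter> t = {}" "\<exists>\<^sub>F c in sequentially. {c..<a c} \<subseteq> s"
          "\<exists>\<^sub>F c in sequentially. {c..<a c} \<subseteq> t"
          "\<forall>i\<in>J. \<exists>\<^sub>F n in sequentially. n \<in> {n. \<forall>a'\<in>snd i. misses (q a') (fst i) n} \<and>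
             (s \<union> t) \<inter> {n..<fst i n} = {}"
        by (elim exE conjE)
      have "P q a (s, t)"
        unfolding P_def big_pair_def
      proof (intro impI conjI ballI)
        fix b A
        assume "b \<in> ?I a" "A \<in> Fpow (?I a)" "\<exists>\<^sub>F n in sequentially. \<forall>a'\<in>A. misses (q a') b n"
        then have "(b, A) \<in> J" unfolding J_def by simp
        from bspec[OF st(4) this]
        show "\<exists>\<^sub>F n in sequentially. (\<forall>a'\<in>A. misses (q a') b n) \<and> misses (s, t) b n"
          by (simp add: misses_def)
      qed (use st in simp_all)
      then show ?thesis ..
    qed (simp add: P_def)
  qed
  then obtain q where q: "\<And>a. P q a (q a)" by blast
  have "\<exists>\<^sub>F n in sequentially. \<forall>a\<in>A. misses (q a) b n"
    if "finite A" "\<forall>a\<in>A. (b, a) \<in> less_D" for A b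
    using that
  proof (induction "card A" arbitrary: A)
    case 0
    then show ?case by (simp add: frequently_const)
  next
    case (Suc k)
    have "A \<noteq> {}" using Suc.hyps(2) by auto
    have "A \<subseteq> D" using Suc.prems(2) less_D_in by blast
    \<comment> \<open>Split off the last index m: b and the rest of A precede it, so the requirement
      met at m extends the induction hypothesis to A.\<close>
    obtain m where m: "m \<in> A" "\<forall>a\<in>A. a = m \<or> (a, m) \<in> less_D"
      using maximal_in_finite[OF Suc.prems(1) \<open>A \<noteq> {}\<close> \<open>A \<subseteq> D\<close>] by blast
    have "\<exists>\<^sub>F n in sequentially. \<forall>a\<in>A - {m}. misses (q a) b n"
      using Suc m(1) by (intro Suc.hyps(1)) auto
    moreover have "b \<in> ?I m" "A - {m} \<in> Fpow (?I m)" "m \<in> D"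
      using Suc.prems m \<open>A \<subseteq> D\<close> unfolding Fpow_def by auto
    ultimately have "\<exists>\<^sub>F n in sequentially. (\<forall>a\<in>A - {m}. misses (q a) b n) \<and> misses (q m) b n"
      using q[of m] unfolding P_def by blast
    then show ?case by (rule frequently_elim1) blast
  qed
  moreover have "\<forall>a\<in>D. big_pair a (q a)" using q unfolding P_def by blast
  ultimately show ?thesis by blast
qed

text \<open>If T were unbounded, the closed initial segments up to its members would cover D by few
  small pieces.\<close>

lemma bounded_if_no_small_splitting:
  assumes no: "\<And>Y. small Y \<Longrightarrow> \<not> finitely_splitting Y" and T: "small T" "T \<subseteq> D"
  shows "\<exists>d\<in>D. \<forall>t\<in>T. (t, d) \<in> less_D"
proof (rule ccontr)
  assume none: "\<not> (\<exists>d\<in>D. \<forall>t\<in>T. (t, d) \<in> less_D)"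
  have "D \<subseteq> (\<Union>t\<in>T. {t} \<union> {b. (b, t) \<in> less_D})"
  proof
    fix d assume "d \<in> D"
    with none obtain t where "t \<in> T" "(t, d) \<notin> less_D" by blast
    then show "d \<in> (\<Union>t\<in>T. {t} \<union> {b. (b, t) \<in> less_D})"
      using less_D_total[of t d] T(2) \<open>d \<in> D\<close> by blast
  qed
  moreover have "small ({t} \<union> {b. (b, t) \<in> less_D})" if "t \<in> T" for t
  proof (rule small_Un)
    show "small {t}" by (rule small_countable) simp
    show "small {b. (b, t) \<in> less_D}" using T(2) that by (intro small_below) auto
  qed
  ultimately have "\<exists>Y. small Y \<and> finitely_splitting Y"
    using small_finitely_splitting[OF T(1), of "\<lambda>t. {t} \<union> {b. (b, t) \<in> less_D}"] by simp
  with no show False by blast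
qed

end

section \<open>The two cases\<close>

lemma infinite_if_frequently_contains:
  assumes "\<And>n. n < f n" "\<exists>\<^sub>F c in sequentially. {c..<f c} \<subseteq> s"
  shows "infinite s"
  unfolding infinite_nat_iff_unbounded_le
proof
  fix N
  obtain c where "c \<ge> N" "{c..<f c} \<subseteq> s"
    using assms(2) unfolding frequently_sequentially by blast
  then show "\<exists>n\<ge>N. n \<in> s" using assms(1)[of c] by auto
qed

lemma frequently_contains_mono:
  assumes "\<exists>\<^sub>F c in sequentially. {c..<d c} \<subseteq> s" "\<forall>\<^sub>F c in sequentially. f c \<le> d c"
  shows "\<exists>\<^sub>F c :: nat in sequentially. {c..<f c :: nat} \<subseteq> s"
  using frequently_eventually_frequently[OF assms] by (rule frequently_elim1) fastforce

context minimal_dominating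
begin

text \<open>The criterion holds with F' = F: the space has fewer than \<delta> finite subsets, so
  one G escapes all the functions h F and nothing remains to be missed.\<close>

lemma witness_of_small_splitting:
  assumes Y: "small Y" "finitely_splitting Y"
  shows "\<exists>S. S_fin (omega_covers (top_of_set (enc ` S))) (omega_covers (top_of_set (enc ` S))) \<and>
    \<not> U_fin (top_of_set (enc ` S)) (open_covers (top_of_set (enc ` S))) (tau_covers (top_of_set (enc ` S)))"
proof (intro exI conjI)
  \<comment> \<open>Discarding the sets with finite complement secures the coinfiniteness that
    \<open>not_U_fin_enc_image\<close> asks for.\<close>
  let ?S = "Collect finite \<union> {x \<in> Y \<union> uminus ` Y. infinite (- x)}"
  have "small (Collect finite :: nat set set)"
    by (intro small_countable countable_Collect_finite)
  moreover have "small {x \<in> Y \<union> uminus ` Y. infinite (- x)}"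
    by (rule small_subset[OF small_Un[OF Y(1) small_image[OF Y(1)]]]) blast
  ultimately have "small ?S" by (rule small_Un)
  note small_fin = small_Fpow[OF this]
  show "S_fin (omega_covers (top_of_set (enc ` ?S))) (omega_covers (top_of_set (enc ` ?S)))"
  proof (rule S_fin_omega_covers_enc_image)
    fix h :: "nat set set \<Rightarrow> nat \<Rightarrow> nat"
    obtain G where G: "\<And>F. F \<in> Fpow ?S \<Longrightarrow> \<exists>\<^sub>F n in sequentially. h F n < G n"
      using escape[OF small_fin, of h] by blast
    have "\<exists>F'\<subseteq>F. \<exists>n. h F' n \<le> G n \<and> (\<forall>x\<in>F - F'. x \<inter> {n..<h F' n} = {})"
      if "finite F" "F \<subseteq> ?S" for F
    proof -
      have "\<exists>\<^sub>F n in sequentially. h F n < G n" by (rule G) (use that in \<open>simp add: Fpow_def\<close>)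
      then obtain n where "h F n < G n" using frequently_ex by blast
      then show ?thesis by (intro exI[of _ F] conjI subset_refl exI[of _ n]) auto
    qed
    then show "\<exists>G. \<forall>F. finite F \<and> F \<subseteq> ?S \<longrightarrow>
      (\<exists>F'\<subseteq>F. \<exists>n. h F' n \<le> G n \<and> (\<forall>x\<in>F - F'. x \<inter> {n..<h F' n} = {}))"
      by (intro exI[of _ G] allI impI) (elim conjE)
  qed simp
  show "\<not> U_fin (top_of_set (enc ` ?S)) (open_covers (top_of_set (enc ` ?S))) (tau_covers (top_of_set (enc ` ?S)))"
  proof (rule not_U_fin_enc_image)
    fix f :: "nat \<Rightarrow> nat"
    \<comment> \<open>With the majorant the intervals are nonempty, so y and its complement are both
      infinite and neither was discarded.\<close>
    obtain y where y: "y \<in> Y" "\<exists>\<^sub>F c in sequentially. {c..<majorant f c} \<subseteq> y"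
        "\<exists>\<^sub>F c in sequentially. {c..<majorant f c} \<inter> y = {}"
      using Y(2) unfolding finitely_splitting_def by blast
    have y': "\<exists>\<^sub>F c in sequentially. {c..<majorant f c} \<subseteq> - y"
      using y(3) by (rule frequently_elim1) blast
    have "infinite y"
      by (rule infinite_if_frequently_contains[OF growingD(1)[OF majorant_growing] y(2)])
    moreover have "infinite (- y)"
      by (rule infinite_if_frequently_contains[OF growingD(1)[OF majorant_growing] y'])
    ultimately have "y \<in> ?S" "- y \<in> ?S" using y(1) by auto
    moreover have "\<forall>\<^sub>F c in sequentially. f c \<le> majorant f c"
      by (simp add: le_majorant)
    ultimately show "\<exists>s\<in>?S. \<exists>t\<in>?S. s \<inter> t = {} \<and>
        (\<exists>\<^sub>F c in sequentially. {c..<f c} \<subseteq> s) \<and> (\<exists>\<^sub>F c in sequentially. {c..<f c} \<subseteq> t)"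
      using frequently_contains_mono[OF y(2)] frequently_contains_mono[OF y']
      by (intro bexI[of _ y] bexI[of _ "- y"]) simp_all
  qed auto
qed

text \<open>The finite sets and the members of all sparse pairs form the witness. For
  \<open>U_fin\<close>, the pair at some d eventually above f is used. For \<open>S_fin\<close>, a
  countable chain closed under the relevant bounds separates the indices of F into those put into F'
  and those late enough to miss the interval.\<close>

lemma witness_of_boundedness:
  assumes bounded: "\<And>T. small T \<Longrightarrow> T \<subseteq> D \<Longrightarrow> \<exists>d\<in>D. \<forall>t\<in>T. (t, d) \<in> less_D"
  shows "\<exists>S. S_fin (omega_covers (top_of_set (enc ` S))) (omega_covers (top_of_set (enc ` S))) \<and>
    \<not> U_fin (top_of_set (enc ` S)) (open_covers (top_of_set (enc ` S))) (tau_covers (top_of_set (enc ` S)))"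
proof -
  from sparse_family_exists obtain q where q: "\<forall>a\<in>D. big_pair a (q a)"
    "\<forall>b A. finite A \<longrightarrow> (\<forall>a\<in>A. (b, a) \<in> less_D) \<longrightarrow>
      (\<exists>\<^sub>F n in sequentially. \<forall>a\<in>A. misses (q a) b n)"
    by (elim exE conjE)
  note big = bspec[OF q(1)] and sparse = q(2)[rule_format]
  define pts where "pts a = {fst (q a), snd (q a)}" for a
  define S where "S = Collect finite \<union> (\<Union>a\<in>D. pts a)"
  have inf: "infinite (fst (q a))" "infinite (snd (q a))" if "a \<in> D" for a
    using big[OF that] infinite_if_frequently_contains[OF growingD(1)[OF growing[OF that]]]
    unfolding big_pair_def by simp_all
  have "S_fin (omega_covers (top_of_set (enc ` S))) (omega_covers (top_of_set (enc ` S)))"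
  proof (rule S_fin_omega_covers_enc_image)
    fix h :: "nat set set \<Rightarrow> nat \<Rightarrow> nat"
    \<comment> \<open>F' will be some set of points with indices in A; summing over all such sets
      bounds h without knowing which one.\<close>
    define H where "H A n = (\<Sum>F'\<in>Pow (\<Union>a\<in>A. pts a). h F' n)" for A n
    have "\<exists>d. d \<in> D \<and> (\<forall>\<^sub>F n in sequentially. H A n \<le> d n)" for A
      using dominating unfolding dominating_def by blast
    then obtain dom where dom: "\<And>A. dom A \<in> D" "\<And>A. \<forall>\<^sub>F n in sequentially. H A n \<le> dom A n"
      by metis
    let ?below = "\<lambda>b. {a. (a, b) \<in> less_D}"
    \<comment> \<open>Closing off: fewer than \<delta> functions dom A come from finite A below
      \<beta> i, so \<beta> (Suc i) can be put above them all. The union of the initial segments is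
      then closed under dom.\<close>
    have "\<exists>\<beta>. \<forall>i. \<beta> i \<in> D \<and> ((\<beta> i, \<beta> (Suc i)) \<in> less_D \<and>
        (\<forall>A\<in>Fpow (?below (\<beta> i)). (dom A, \<beta> (Suc i)) \<in> less_D))"
    proof (rule dependent_nat_choice)
      show "\<exists>b. b \<in> D" using infinite_D by (metis finite.emptyI ex_in_conv)
      fix b and i :: nat assume b: "b \<in> D"
      have "small ({b} \<union> dom ` Fpow (?below b))"
        by (intro small_Un small_image small_Fpow small_below b small_countable) simp
      from bounded[OF this] b dom(1)
      show "\<exists>b'. b' \<in> D \<and> ((b, b') \<in> less_D \<and> (\<forall>A\<in>Fpow (?below b). (dom A, b') \<in> less_D))"
        by auto
    qed
    then obtain \<beta> where \<beta>: "\<And>i. \<beta> i \<in> D" "\<And>i. (\<beta> i, \<beta> (Suc i)) \<in> less_D"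
        "\<And>i A. A \<in> Fpow (?below (\<beta> i)) \<Longrightarrow> (dom A, \<beta> (Suc i)) \<in> less_D"
      by auto
    have "small (range \<beta>)" by (intro small_countable) simp
    then obtain \<gamma> where \<gamma>: "\<gamma> \<in> D" "\<And>i. (\<beta> i, \<gamma>) \<in> less_D"
      using bounded[of "range \<beta>"] \<beta>(1) by auto
    \<comment> \<open>G depends on \<gamma> alone. If the pair at \<gamma> misses [n, b n), the next
      element of its first set is at least b n, so G n bounds b n for a b not known in
      advance.\<close>
    define G where "G n = next_in (fst (q \<gamma>)) n" for n
    have G: "b n \<le> G n" if "misses (q \<gamma>) b n" for b n
      using that next_in[OF inf(1)[OF \<gamma>(1)], of n] unfolding misses_def G_def
      by (metis Int_iff Un_iff atLeastLessThan_iff empty_iff linorder_not_le)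
    have \<beta>_mono: "?below (\<beta> i) \<subseteq> ?below (\<beta> j)" if "i \<le> j" for i j
      using that by (rule lift_Suc_mono_le[rotated]) (use \<beta>(2) trans_less_D in blast)
    have "\<exists>F'\<subseteq>F. \<exists>n. h F' n \<le> G n \<and> (\<forall>x\<in>F - F'. x \<inter> {n..<h F' n} = {})"
      if F: "finite F" "F \<subseteq> S" for F
    proof -
      have "\<forall>x\<in>F - Collect finite. \<exists>a\<in>D. x \<in> pts a" using F(2) unfolding S_def by blast
      then obtain index where index: "\<And>x. x \<in> F - Collect finite \<Longrightarrow> index x \<in> D \<and> x \<in> pts (index x)"
        by metis
      define A where "A = index ` (F - Collect finite)"
      \<comment> \<open>Indices captured by the chain. They all lie below a single \<beta> i, so dom
        A1 precedes \<beta> (Suc i), hence \<gamma> and every index left over.\<close>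
      define A1 where "A1 = A \<inter> (\<Union>i. ?below (\<beta> i))"
      have "finite A" unfolding A_def using F(1) by simp
      have "finite A1" unfolding A1_def using \<open>finite A\<close> by simp
      moreover have "A1 \<subseteq> (\<Union>i. ?below (\<beta> i))" unfolding A1_def by blast
      ultimately have "\<exists>i. A1 \<subseteq> ?below (\<beta> i)"
      proof (induction A1 rule: finite_induct)
        case (insert a B)
        then obtain i j where "B \<subseteq> ?below (\<beta> i)" "a \<in> ?below (\<beta> j)" by auto
        then have "insert a B \<subseteq> ?below (\<beta> (max i j))"
          using \<beta>_mono[of i "max i j"] \<beta>_mono[of j "max i j"] by auto
        then show ?case by blast
      qed simp
      then obtain i where "A1 \<subseteq> ?below (\<beta> i)" by blast
      with \<open>finite A1\<close> have dom_less: "(dom A1, \<beta> (Suc i)) \<in> less_D"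
        by (intro \<beta>(3)) (simp add: Fpow_def)
      have above: "(dom A1, a) \<in> less_D" if "a \<in> insert \<gamma> (A - A1)" for a
      proof -
        have "(\<beta> (Suc i), a) \<in> less_D"
        proof (cases "a = \<gamma>")
          case False
          with that have a: "a \<in> A" "\<And>j. (a, \<beta> j) \<notin> less_D" unfolding A1_def by auto
          then have "a \<in> D" unfolding A_def using index by blast
          moreover have "a \<noteq> \<beta> (Suc i)" using a(2)[of "Suc (Suc i)"] \<beta>(2)[of "Suc i"] by auto
          ultimately show ?thesis using less_D_total[of a "\<beta> (Suc i)"] \<beta>(1) a(2) by blast
        qed (use \<gamma>(2) in simp)
        with dom_less show ?thesis by (rule trans_less_D)
      qed
      have freq: "\<exists>\<^sub>F n in sequentially. \<forall>a\<in>insert \<gamma> (A - A1). misses (q a) (dom A1) n"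
        using \<open>finite A\<close> above by (intro sparse) auto
      \<comment> \<open>Taking n beyond all elements of the finite members of F makes these miss any
        interval starting at n.\<close>
      have "finite (\<Union>(F \<inter> Collect finite))" using F(1) by auto
      then obtain N where "\<forall>m\<in>\<Union>(F \<inter> Collect finite). m < N"
        unfolding finite_nat_set_iff_bounded ..
      then have N: "\<And>x m. x \<in> F \<Longrightarrow> finite x \<Longrightarrow> m \<in> x \<Longrightarrow> m < N" by blast
      obtain n where n: "n \<ge> N" "H A1 n \<le> dom A1 n" "\<And>a. a \<in> insert \<gamma> (A - A1) \<Longrightarrow> misses (q a) (dom A1) n"
        using frequently_ex[OF frequently_eventually_frequently[OF freq
            eventually_conj[OF eventually_ge_at_top[of N] dom(2)[of A1]]]]
        by auto
      define F' where "F' = F \<inter> (\<Union>a\<in>A1. pts a)"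
      have "h F' n \<le> H A1 n"
        unfolding H_def by (rule member_le_sum) (use \<open>finite A1\<close> in \<open>auto simp: F'_def pts_def\<close>)
      then have h: "h F' n \<le> dom A1 n" using n(2) by simp
      have "x \<inter> {n..<h F' n} = {}" if x: "x \<in> F - F'" for x
      proof (cases "finite x")
        case True
        then show ?thesis using N[of x] n(1) x by fastforce
      next
        case False
        with x have "x \<in> F - Collect finite" by simp
        from index[OF this] this have a: "x \<in> pts (index x)" "index x \<in> A" unfolding A_def by auto
        with x have "index x \<in> A - A1" unfolding F'_def by auto
        then have "misses (q (index x)) (dom A1) n" by (intro n(3)) simp
        moreover have "x \<subseteq> fst (q (index x)) \<union> snd (q (index x))"
          using a(1) unfolding pts_def by auto
        moreover have "{n..<h F' n} \<subseteq> {n..<dom A1 n}" using h by auto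
        ultimately show ?thesis unfolding misses_def by blast
      qed
      moreover have "h F' n \<le> G n" using h G[OF n(3)[of \<gamma>]] by simp
      moreover have "F' \<subseteq> F" unfolding F'_def by blast
      ultimately show ?thesis by blast
    qed
    then show "\<exists>G. \<forall>F. finite F \<and> F \<subseteq> S \<longrightarrow>
      (\<exists>F'\<subseteq>F. \<exists>n. h F' n \<le> G n \<and> (\<forall>x\<in>F - F'. x \<inter> {n..<h F' n} = {}))"
      by (intro exI[of _ G] allI impI) (elim conjE)
  qed (simp add: S_def)
  moreover have "\<not> U_fin (top_of_set (enc ` S)) (open_covers (top_of_set (enc ` S))) (tau_covers (top_of_set (enc ` S)))"
  proof (rule not_U_fin_enc_image)
    fix x assume "x \<in> S"
    then consider "finite x" | a where "a \<in> D" "x \<in> pts a" unfolding S_def by blast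
    then show "infinite (- x)"
    proof cases
      case 1
      then show ?thesis by simp
    next
      case 2
      then have "snd (q a) \<subseteq> - x \<or> fst (q a) \<subseteq> - x"
        using big[OF 2(1)] unfolding big_pair_def pts_def by auto
      then show ?thesis using inf[OF 2(1)] finite_subset by blast
    qed
  next
    fix f :: "nat \<Rightarrow> nat"
    obtain d where d: "d \<in> D" "\<forall>\<^sub>F n in sequentially. f n \<le> d n"
      using dominating unfolding dominating_def by blast
    have "fst (q d) \<in> S" "snd (q d) \<in> S" using d(1) unfolding S_def pts_def by blast+
    then show "\<exists>s\<in>S. \<exists>t\<in>S. s \<inter> t = {} \<and>
        (\<exists>\<^sub>F c in sequentially. {c..<f c} \<subseteq> s) \<and> (\<exists>\<^sub>F c in sequentially. {c..<f c} \<subseteq> t)"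
      using big[OF d(1)] frequently_contains_mono[OF _ d(2)] unfolding big_pair_def
      by (intro bexI[of _ "fst (q d)"] bexI[of _ "snd (q d)"]) simp_all
  qed (simp add: S_def)
  ultimately show ?thesis by blast
qed

end

theorem theorem8p10:
  shows "\<exists>X :: real set.
    set_of_reals (top_of_set X) \<and>
    S_fin (omega_covers (top_of_set X)) (omega_covers (top_of_set X)) \<and>
    \<not> U_fin (top_of_set X) (open_covers (top_of_set X)) (tau_covers (top_of_set X))"
proof -
  obtain D where "minimal_dominating D" using minimal_dominating_exists by blast
  then interpret minimal_dominating D .
  have "\<exists>S. S_fin (omega_covers (top_of_set (enc ` S))) (omega_covers (top_of_set (enc ` S))) \<and>
    \<not> U_fin (top_of_set (enc ` S)) (open_covers (top_of_set (enc ` S))) (tau_covers (top_of_set (enc ` S)))"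
  proof (cases "\<exists>Y. small Y \<and> finitely_splitting Y")
    case True
    then show ?thesis using witness_of_small_splitting by blast
  next
    case False
    then show ?thesis
      by (intro witness_of_boundedness bounded_if_no_small_splitting) blast
  qed
  then show ?thesis using set_of_reals_enc_image by blast
qed

end
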